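(* Consider all sequences of polynomials $P_n(x)=a_nx^n+\ldots\in\mathbb{Z}_n^s([-1,1])$, $n\in\mathbb{N}$. Let $L$ be the infimum of $\liminf_{n\to\infty}|a_n|^{1/n}$ among all such sequences. Then $$1.53770952\le L\le 1.54170092.$$
   Context: For $E\subset\mathbb{C}$, $\mathbb{Z}_n^s(E)$ denotes the set of polynomials with integer coefficients, of exact degree $n$, all of whose (complex) zeros are simple and lie in $E$. The number $a_n\ne 0$ is the leading coefficient of $P_n$. *)

theory Defs
  imports Complex_Main "HOL-Computational_Algebra.Polynomial" "HOL-Library.Extended_Real"
begin

definition simple_zero_polys :: "nat \<Rightarrow> complex set \<Rightarrow> int poly set" where
  "simple_zero_polys n E =
     {p. p \<noteq> 0 \<and> degree p = n \<and>
         (\<forall>z::complex. poly (map_poly of_int p) z = 0 \<longrightarrow>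
            z \<in> E \<and> order z (map_poly of_int p) = 1)}"

text \<open>
  The sequence is indexed by the positive integers (the value at 0 is unconstrained and does not
  affect the limit inferior). Both the limit inferior and the infimum are taken in the extended
  reals, since leading coefficients may grow superexponentially.
\<close>

definition min_leading_growth :: "complex set \<Rightarrow> ereal" where
  "min_leading_growth E =
     (INF P \<in> {P :: nat \<Rightarrow> int poly. \<forall>n\<ge>1. P n \<in> simple_zero_polys n E}.
        liminf (\<lambda>n. ereal (root n \<bar>real_of_int (lead_coeff (P n))\<bar>)))"

end

theory Submission
  imports Defs "Subresultants.Subresultant_Gcd" "HOL-Analysis.Harmonic_Numbers"
    "HOL-Computational_Algebra.Fundamental_Theorem_Algebra"
begin

text \<open>
Both bounds come from comparing an integer polynomial with the logarithmic size of its roots.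

\<^bold>\<open>Lower bound.\<close>  If integer polynomials \<open>P\<close> and \<open>Q\<close> have no common root, their resultant is a nonzero
integer, so \<open>\<bar>a\<bar>\<^sup>k \<cdot> \<Prod>\<bar>Q(x)\<bar> \<ge> 1\<close>, where \<open>a\<close> is the leading coefficient of \<open>P\<close>, \<open>k\<close> is the degree of \<open>Q\<close>
and \<open>x\<close> runs through the roots of \<open>P\<close> (\<open>one_le_norm_prod_proots\<close>).  Take finitely many \<open>Q\<close> with
weights \<open>c\<close>.  If the weighted sum of the \<open>ln \<bar>Q(x)\<bar>\<close> is at most \<open>-m\<close> on the whole of \<open>[-1,1]\<close>, then adding
the logarithms of these inequalities bounds \<open>ln \<bar>a\<bar>\<close> from below by \<open>m/(\<Sum>c deg Q)\<close> per root
(\<open>auxiliary_function_bound\<close>).  A common factor of \<open>P\<close> and the product of the \<open>Q\<close> has bounded degree; it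
can be divided out, and since the zeros of \<open>P\<close> are simple the cofactor shares no root with any \<open>Q\<close>.

The \<open>Q\<close> used here are polynomials \<open>q\<close> in \<open>t = x\<^sup>2 - x\<^sup>4\<close>, a variable that runs through \<open>[0,1/4]\<close>; the \<open>q\<close>
have all their roots in that interval.  Hence between consecutive roots of all the \<open>q\<close> the weighted sum of the
\<open>ln \<bar>q(t)\<bar>\<close> is concave and lies below each of its tangents.  One rational point close to each local
maximum, where the tangent is almost horizontal, therefore settles the whole interval
(\<open>tangent_at_separating_point\<close>).  That these points separate the roots, and that each \<open>q\<close> is
real-rooted, both follow from counting sign changes.  All numerical conditions are inequalities between
integers, checked by rewriting (\<open>log_sum_le\<close>).

\<^bold>\<open>Upper bound.\<close>  The rational map \<open>u(x) = x(1-x)/(1-3x(1-x))\<close> sends \<open>[0,1]\<close> two-to-one onto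
itself.  Pulling back the root \<open>1/2\<close> of \<open>2x - 1\<close> repeatedly yields integer polynomials of degree \<open>2\<^sup>n\<close> with
\<open>2\<^sup>n\<close> distinct roots in \<open>(0,1)\<close>, the Gorshkov polynomials; the substitution of \<open>x\<^sup>2\<close> moves them to \<open>[-1,1]\<close>.
Their leading coefficients obey a two-term recursion, whose growth rate is evaluated with
rational bounds.  As a limit inferior is bounded by the values along a subsequence, the remaining degrees
may be filled with arbitrary polynomials.
\<close>

hide_const (open) Module.smult

section \<open>Resultants and products over roots\<close>

lemma norm_prod_mset_linear:
  "norm (poly (\<Prod>x\<in>#A. [:-x, 1:]) (y::complex)) = (\<Prod>x\<in>#A. norm (y - x))"
  by (induction A) (simp_all add: norm_mult poly_mult del: mult_pCons_left)

lemma norm_poly_eq_prod_proots: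
  fixes p :: "complex poly"
  shows "norm (poly p y) = norm (lead_coeff p) * (\<Prod>x\<in>#proots p. norm (y - x))"
proof -
  have "poly p y = poly (smult (lead_coeff p) (\<Prod>x\<in>#proots p. [:-x, 1:])) y"
    by (simp only: complex_poly_decompose_multiset)
  also have "\<dots> = lead_coeff p * poly (\<Prod>x\<in>#proots p. [:-x, 1:]) y" by (simp only: poly_smult)
  finally show ?thesis by (simp only: norm_mult norm_prod_mset_linear)
qed

text \<open>
Both sides equal \<open>\<bar>a\<bar>\<^sup>n \<bar>b\<bar>\<^sup>m \<Prod>\<Prod>\<bar>x - y\<bar>\<close>, with \<open>a\<close>, \<open>b\<close> the leading coefficients, \<open>m\<close>, \<open>n\<close> the degrees
and \<open>x\<close>, \<open>y\<close> running through the roots of \<open>f\<close> and \<open>g\<close>.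
\<close>

lemma prod_proots_swap:
  fixes f g :: "complex poly"
  shows "norm (lead_coeff f) ^ degree g * (\<Prod>x\<in>#proots f. norm (poly g x)) =
         norm (lead_coeff g) ^ degree f * (\<Prod>y\<in>#proots g. norm (poly f y))"
proof -
  have "(\<Prod>x\<in>#proots f. norm (poly g x)) =
        norm (lead_coeff g) ^ degree f * (\<Prod>x\<in>#proots f. \<Prod>y\<in>#proots g. norm (x - y))"
    by (subst norm_poly_eq_prod_proots)
       (simp add: prod_mset.distrib size_proots_complex)
  moreover have "(\<Prod>y\<in>#proots g. norm (poly f y)) =
        norm (lead_coeff f) ^ degree g * (\<Prod>y\<in>#proots g. \<Prod>x\<in>#proots f. norm (y - x))"
    by (subst norm_poly_eq_prod_proots)
       (simp add: prod_mset.distrib size_proots_complex)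
  moreover have "(\<Prod>x\<in>#proots f. \<Prod>y\<in>#proots g. norm (x - y)) =
                 (\<Prod>y\<in>#proots g. \<Prod>x\<in>#proots f. norm (y - x))"
    by (subst prod_mset.swap) (simp add: norm_minus_commute)
  ultimately show ?thesis by simp
qed

text \<open>
Both sides behave alike under the Euclidean algorithm: they are symmetric in \<open>f\<close> and \<open>g\<close>, and replacing the polynomial of
larger degree by its remainder modulo the other one changes both by the same power of a leading
coefficient, because the remainder takes the same values at the roots.  Only absolute values are compared,
so no signs have to be tracked.
\<close>

lemma norm_resultant:
  fixes f g :: "complex poly"
  assumes "f \<noteq> 0" "g \<noteq> 0"
  shows "norm (resultant f g) = norm (lead_coeff f) ^ degree g * (\<Prod>x\<in>#proots f. norm (poly g x))"
  using assms
proof (induction "degree f + degree g" arbitrary: f g rule: less_induct)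
  case less
  have main: "norm (resultant p q) = norm (lead_coeff q) ^ degree p * (\<Prod>x\<in>#proots q. norm (poly p x))"
    if p: "p \<noteq> 0" and q: "q \<noteq> 0" and deg: "degree q \<le> degree p" "degree p + degree q = degree f + degree g"
    for p q :: "complex poly"
  proof (cases "degree q = 0")
    case True
    then obtain c where "q = [:c:]" by (metis degree_eq_zeroE)
    with q show ?thesis by (simp add: norm_power)
  next
    case False
    define h where "h = p mod q"
    have h: "p + (- (p div q)) * q = h" unfolding h_def
      by (simp add: minus_div_mult_eq_mod)
    have dh: "h = 0 \<or> degree h < degree q" unfolding h_def using q by (rule degree_mod_less)
    have root: "poly p x = poly h x" if "x \<in># proots q" for x
      using that q unfolding h[symmetric] by simp
    have dh': "degree q > degree h \<or> h = 0 \<and> p \<noteq> 0 \<and> q \<noteq> 0" using dh p q by auto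
    have dlt: "degree h < degree q" using dh False by auto
    show ?thesis
    proof (cases "degree h = 0")
      case True
      then obtain c where c: "h = [:c:]" by (metis degree_eq_zeroE)
      have "subresultant 0 p q = smult ((-1)^(degree p * degree q) * lead_coeff q ^ degree p * c ^ (degree q - 1)) h"
        using BT_lemma_1_13[OF h deg(1) dh'] dlt True c by simp
      hence "resultant p q = (-1)^(degree p * degree q) * lead_coeff q ^ degree p * (c ^ (degree q - 1) * c)"
        unfolding subresultant_resultant c by simp
      also have "c ^ (degree q - 1) * c = c ^ degree q"
        using False by (metis bot_nat_0.not_eq_extremum power_minus_mult)
      finally have "norm (resultant p q) = norm (lead_coeff q) ^ degree p * norm c ^ degree q"
        by (simp add: norm_mult norm_power)
      moreover have "(\<Prod>x\<in>#proots q. norm (poly p x)) = (\<Prod>x\<in>#proots q. norm c)"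
        using root c by (intro arg_cong[where f = prod_mset] image_mset_cong) simp
      ultimately show ?thesis by (simp add: size_proots_complex)
    next
      case False
      hence h0: "h \<noteq> 0" by auto
      have "subresultant 0 p q = smult ((-1)^(degree p * degree q) * lead_coeff q ^ (degree p - degree h)) (subresultant 0 q h)"
        using BT_lemma_1_12[OF h deg(1) dh'] False by simp
      hence "resultant p q = (-1)^(degree p * degree q) * lead_coeff q ^ (degree p - degree h) * resultant q h"
        unfolding subresultant_resultant by simp
      hence "norm (resultant p q) = norm (lead_coeff q) ^ (degree p - degree h) * norm (resultant q h)"
        by (simp add: norm_mult norm_power)
      also have "norm (resultant q h) = norm (lead_coeff q) ^ degree h * (\<Prod>x\<in>#proots q. norm (poly h x))"
        using less.hyps[of q h] q h0 dlt deg by simp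
      also have "norm (lead_coeff q) ^ (degree p - degree h) * \<dots> =
        norm (lead_coeff q) ^ degree p * (\<Prod>x\<in>#proots q. norm (poly h x))"
        using dlt deg(1) by (simp add: mult.assoc[symmetric] power_add[symmetric])
      also have "(\<Prod>x\<in>#proots q. norm (poly h x)) = (\<Prod>x\<in>#proots q. norm (poly p x))"
        using root by (intro arg_cong[where f = prod_mset] image_mset_cong) simp
      finally show ?thesis .
    qed
  qed
  have swap: "norm (resultant f g) = norm (resultant g f)"
    by (subst resultant_swap) (simp add: norm_mult norm_power)
  show ?case
  proof (cases "degree g \<le> degree f")
    case True
    from main[OF less.prems this refl] show ?thesis by (simp add: prod_proots_swap)
  next
    case False
    with main[of g f] less.prems swap show ?thesis by simp
  qed
qed

abbreviation cpoly :: "int poly \<Rightarrow> complex poly" where "cpoly \<equiv> map_poly of_int"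

text \<open>
The right-hand side is the absolute value of the resultant, an integer that vanishes only if
\<open>f\<close> and \<open>g\<close> have a common factor of positive degree.
\<close>

lemma one_le_norm_prod_proots:
  fixes f g :: "int poly"
  assumes "f \<noteq> 0" "g \<noteq> 0" "degree (gcd f g) = 0"
  shows "1 \<le> norm (of_int (lead_coeff f) :: complex) ^ degree g * (\<Prod>x\<in>#proots (cpoly f). norm (poly (cpoly g) x))"
proof -
  have "resultant f g \<noteq> 0" using assms by (simp add: resultant_0_gcd)
  hence "1 \<le> norm (of_int (resultant f g) :: complex)" by simp
  also have "of_int (resultant f g) = resultant (cpoly f) (cpoly g)" by (simp add: of_int_hom.resultant_hom)
  also have "norm \<dots> = norm (lead_coeff (cpoly f)) ^ degree (cpoly g) * (\<Prod>x\<in>#proots (cpoly f). norm (poly (cpoly g) x))"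
    using assms by (intro norm_resultant) auto
  finally show ?thesis by simp
qed

section \<open>The method of auxiliary functions\<close>

lemma ln_prod_mset:
  "(\<And>x. x \<in># A \<Longrightarrow> f x > (0::real)) \<Longrightarrow> ln (\<Prod>x\<in>#A. f x) = (\<Sum>x\<in>#A. ln (f x))"
proof (induction A)
  case (add x A)
  have "(\<Prod>x\<in>#A. f x) > 0" using add.prems
    by (induction A) (auto intro!: mult_pos_pos)
  moreover have "f x > 0" using add.prems by simp
  ultimately have "ln (\<Prod>y\<in>#add_mset x A. f y) = ln (f x) + ln (\<Prod>x\<in>#A. f x)"
    by (simp only: image_mset_add_mset prod_mset.add_mset ln_mult_pos)
  with add show ?case by simp
qed simp

lemma sum_mset_le_const:
  "(\<And>x. x \<in># A \<Longrightarrow> f x \<le> (c::real)) \<Longrightarrow> (\<Sum>x\<in>#A. f x) \<le> c * real (size A)"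
  by (induction A) (force simp: algebra_simps)+

lemma sum_sum_mset_swap:
  "(\<Sum>i\<in>I. \<Sum>x\<in>#A. f i x) = (\<Sum>x\<in>#A. \<Sum>i\<in>I. (f i x :: real))"
  by (induction A) (simp_all add: sum.distrib)

lemma coprime_no_common_root:
  fixes f g :: "int poly"
  assumes "f \<noteq> 0" "g \<noteq> 0" "degree (gcd f g) = 0" "poly (cpoly f) z = 0"
  shows "poly (cpoly g) z \<noteq> 0"
proof
  assume "poly (cpoly g) z = 0"
  moreover have "z \<in># proots (cpoly f)" using assms by simp
  ultimately have "(\<Prod>x\<in>#proots (cpoly f). norm (poly (cpoly g) x)) = 0"
    by (auto simp: prod_mset_zero_iff)
  with one_le_norm_prod_proots[OF assms(1-3)] show False by simp
qed

lemma degree_gcd_eq_0I: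
  fixes f g :: "int poly"
  assumes "f \<noteq> 0" "\<And>z. poly (cpoly f) z = 0 \<Longrightarrow> poly (cpoly g) z \<noteq> 0"
  shows "degree (gcd f g) = 0"
proof (rule ccontr)
  assume "degree (gcd f g) \<noteq> 0"
  hence "\<not> constant (poly (cpoly (gcd f g)))" by (simp add: constant_degree)
  then obtain z where z: "poly (cpoly (gcd f g)) z = 0"
    using fundamental_theorem_of_algebra by blast
  have "poly (cpoly h) z = 0" if "gcd f g dvd h" for h
    using that z by (auto simp: of_int_poly_hom.hom_mult elim!: dvdE)
  with assms(2)[of z] show False by simp
qed

text \<open>
\<open>R\<close> is \<open>P\<close> divided by its gcd with \<open>W\<close>.  A common root of \<open>R\<close> and \<open>W\<close> cannot be a root of the
cofactor of \<open>W\<close>, which is coprime to \<open>R\<close>; so it would be a root of the gcd as well and a double root of \<open>P\<close>.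
\<close>

lemma remove_common_factor:
  fixes P W :: "int poly"
  assumes P: "P \<noteq> 0" and W: "W \<noteq> 0"
    and simple: "\<And>z. poly (cpoly P) z = 0 \<Longrightarrow> Polynomial.order z (cpoly P) = 1"
  obtains R where "R dvd P" "degree P \<le> degree R + degree W"
    "\<And>z. poly (cpoly R) z = 0 \<Longrightarrow> poly (cpoly W) z \<noteq> 0"
proof -
  define G where "G = gcd P W"
  obtain R W' where RW: "P = R * G" "W = W' * G" "coprime R W'"
    using gcd_coprime_exists[of P W] P unfolding G_def by auto
  have nz: "R \<noteq> 0" "G \<noteq> 0" "W' \<noteq> 0" using P W RW by auto
  have "degree G \<le> degree W" unfolding G_def by (rule dvd_imp_degree_le) (use W in auto)
  hence "degree P \<le> degree R + degree W" using nz by (simp add: RW degree_mult_eq)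
  moreover have "poly (cpoly W) z \<noteq> 0" if z: "poly (cpoly R) z = 0" for z
  proof
    assume "poly (cpoly W) z = 0"
    moreover have "poly (cpoly W') z \<noteq> 0"
      using coprime_no_common_root[OF nz(1,3) _ z] RW(3) by simp
    ultimately have "poly (cpoly G) z = 0" by (simp add: RW(2) of_int_poly_hom.hom_mult)
    with z nz have "Polynomial.order z (cpoly R) \<ge> 1" "Polynomial.order z (cpoly G) \<ge> 1"
      by (simp_all add: order_root Suc_le_eq)
    moreover have "Polynomial.order z (cpoly P) = Polynomial.order z (cpoly R) + Polynomial.order z (cpoly G)"
      using nz by (simp add: RW(1) of_int_poly_hom.hom_mult order_mult)
    moreover have "Polynomial.order z (cpoly P) = 1"
      using z by (intro simple) (simp add: RW(1) of_int_poly_hom.hom_mult)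
    ultimately show False by simp
  qed
  ultimately show ?thesis using that RW(1) by (metis dvd_triv_left)
qed

text \<open>
Summing \<open>ln \<bar>Q(x)\<bar>\<close> over the roots \<open>x\<close> of \<open>P\<close> and with weights over the \<open>Q\<close> gives at least
\<open>-ln \<bar>a\<bar>\<close> times the weighted degree by integrality of the resultants, and at most \<open>-m\<close> for each root by
assumption.  Up to the sum of the degrees of the \<open>Q\<close>, which is independent of \<open>n\<close>, roots may be lost when the
common factor is removed.
\<close>

theorem auxiliary_function_bound:
  fixes Q :: "'i \<Rightarrow> int poly" and c :: "'i \<Rightarrow> real"
  assumes I: "finite I" "\<And>i. i \<in> I \<Longrightarrow> Q i \<noteq> 0" "\<And>i. i \<in> I \<Longrightarrow> c i \<ge> 0" and m: "m \<ge> 0"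
    and aux: "\<And>z. z \<in> E \<Longrightarrow> (\<And>i. i \<in> I \<Longrightarrow> poly (cpoly (Q i)) z \<noteq> 0) \<Longrightarrow>
                (\<Sum>i\<in>I. c i * ln (norm (poly (cpoly (Q i)) z))) \<le> - m"
    and P: "P \<in> simple_zero_polys n E"
  shows "m * (real n - real (\<Sum>i\<in>I. degree (Q i))) \<le>
           (\<Sum>i\<in>I. c i * real (degree (Q i))) * ln \<bar>real_of_int (lead_coeff P)\<bar>"
proof -
  define W where "W = (\<Prod>i\<in>I. Q i)"
  have W: "W \<noteq> 0" using I by (simp add: W_def)
  have degW: "degree W = (\<Sum>i\<in>I. degree (Q i))"
    unfolding W_def using I by (intro degree_prod_eq_sum_degree) auto
  from P have P': "P \<noteq> 0" "degree P = n"
    and P_roots: "\<And>z. poly (cpoly P) z = 0 \<Longrightarrow> z \<in> E \<and> Polynomial.order z (cpoly P) = 1"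
    by (auto simp: simple_zero_polys_def)
  obtain R where R: "R dvd P" "degree P \<le> degree R + degree W"
    "\<And>z. poly (cpoly R) z = 0 \<Longrightarrow> poly (cpoly W) z \<noteq> 0"
    using remove_common_factor[OF P'(1) W] P_roots by metis
  have R0: "R \<noteq> 0" using R(1) P' by auto
  define A where "A = proots (cpoly R)"
  have sizeA: "size A = degree R" by (simp add: A_def size_proots_complex)
  have A_E: "x \<in> E" if "x \<in># A" for x
  proof -
    have "poly (cpoly R) x = 0" using that R0 by (simp add: A_def)
    hence "poly (cpoly P) x = 0" using R(1) by (auto simp: of_int_poly_hom.hom_mult elim!: dvdE)
    thus ?thesis using P_roots by blast
  qed
  have A_Q: "poly (cpoly (Q i)) x \<noteq> 0" if "x \<in># A" "i \<in> I" for i x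
  proof -
    have "poly (cpoly W) x \<noteq> 0" using that R0 R(3) by (simp add: A_def)
    thus ?thesis using that I by (auto simp: W_def of_int_poly_hom.hom_prod poly_prod)
  qed
  define l where "l = ln \<bar>real_of_int (lead_coeff R)\<bar>"
  have pos: "0 \<le> real (degree (Q i)) * l + (\<Sum>x\<in>#A. ln (norm (poly (cpoly (Q i)) x)))" if i: "i \<in> I" for i
  proof -
    have "degree (gcd R (Q i)) = 0"
      using A_Q i R0 by (intro degree_gcd_eq_0I) (auto simp: A_def)
    hence "1 \<le> norm (of_int (lead_coeff R) :: complex) ^ degree (Q i) * (\<Prod>x\<in>#A. norm (poly (cpoly (Q i)) x))"
      unfolding A_def using one_le_norm_prod_proots R0 I(2) i by blast
    hence "0 \<le> ln (\<bar>real_of_int (lead_coeff R)\<bar> ^ degree (Q i) * (\<Prod>x\<in>#A. norm (poly (cpoly (Q i)) x)))"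
      by simp
    also have "\<dots> = real (degree (Q i)) * l + ln (\<Prod>x\<in>#A. norm (poly (cpoly (Q i)) x))"
    proof (subst ln_mult_pos)
      show "0 < (\<Prod>x\<in>#A. norm (poly (cpoly (Q i)) x))"
        using A_Q i by (induction A) (auto intro!: mult_pos_pos)
    qed (use R0 in \<open>simp_all add: l_def ln_realpow\<close>)
    also have "ln (\<Prod>x\<in>#A. norm (poly (cpoly (Q i)) x)) = (\<Sum>x\<in>#A. ln (norm (poly (cpoly (Q i)) x)))"
      using A_Q i by (intro ln_prod_mset) auto
    finally show ?thesis .
  qed
  define D where "D = (\<Sum>i\<in>I. c i * real (degree (Q i)))"
  have D0: "D \<ge> 0" unfolding D_def using I by (intro sum_nonneg) auto
  have "0 \<le> (\<Sum>i\<in>I. c i * (real (degree (Q i)) * l + (\<Sum>x\<in>#A. ln (norm (poly (cpoly (Q i)) x)))))"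
    using pos I by (intro sum_nonneg mult_nonneg_nonneg) auto
  also have "\<dots> = D * l + (\<Sum>i\<in>I. \<Sum>x\<in>#A. c i * ln (norm (poly (cpoly (Q i)) x)))"
    by (simp add: D_def distrib_left sum.distrib sum_distrib_right sum_mset_distrib_left mult.assoc
        image_mset.compositionality o_def)
  also have "(\<Sum>i\<in>I. \<Sum>x\<in>#A. c i * ln (norm (poly (cpoly (Q i)) x))) =
             (\<Sum>x\<in>#A. \<Sum>i\<in>I. c i * ln (norm (poly (cpoly (Q i)) x)))"
    by (rule sum_sum_mset_swap)
  also have "\<dots> \<le> - m * real (size A)"
    using A_E A_Q by (intro sum_mset_le_const aux) auto
  finally have "m * real (degree R) \<le> D * l" by (simp add: sizeA)
  moreover have "m * (real n - real (degree W)) \<le> m * real (degree R)"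
    using R(2) P' m by (intro mult_left_mono) auto
  moreover have "D * l \<le> D * ln \<bar>real_of_int (lead_coeff P)\<bar>"
  proof -
    obtain S where S: "P = R * S" using R(1) by (elim dvdE)
    have "\<bar>lead_coeff S\<bar> \<ge> 1" using S P' by (auto simp: int_one_le_iff_zero_less)
    hence "\<bar>lead_coeff R\<bar> * 1 \<le> \<bar>lead_coeff R\<bar> * \<bar>lead_coeff S\<bar>" by (intro mult_left_mono) auto
    hence "\<bar>lead_coeff R\<bar> \<le> \<bar>lead_coeff P\<bar>" by (simp add: S lead_coeff_mult abs_mult)
    hence "\<bar>real_of_int (lead_coeff R)\<bar> \<le> \<bar>real_of_int (lead_coeff P)\<bar>" by linarith
    hence "l \<le> ln \<bar>real_of_int (lead_coeff P)\<bar>" unfolding l_def using R0 by (intro ln_mono) auto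
    thus ?thesis using D0 by (rule mult_left_mono)
  qed
  ultimately show ?thesis unfolding D_def degW by linarith
qed

section \<open>The Gorshkov polynomials\<close>

text \<open>
A polynomial with as many distinct roots as its degree allows has no further roots and no multiple ones.
\<close>

lemma simple_zero_polysI:
  fixes P :: "int poly" and S :: "real set"
  assumes "P \<noteq> 0" "finite S" "card S = degree P" "S \<subseteq> {-1..1}"
    and root: "\<And>x. x \<in> S \<Longrightarrow> poly (map_poly of_int P) x = 0"
  shows "P \<in> simple_zero_polys (degree P) (complex_of_real ` {-1..1})"
proof -
  define p where "p = (map_poly of_int P :: complex poly)"
  have p0: "p \<noteq> 0"
    using assms(1) by (auto simp: p_def poly_eq_iff coeff_map_poly)
  have deg: "degree p = degree P" by (auto simp: p_def intro: degree_map_poly)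
  have root': "poly p (complex_of_real x) = 0" if "x \<in> S" for x
  proof -
    have "poly p (complex_of_real x) = complex_of_real (poly (map_poly of_int P) x)"
      unfolding p_def by (simp add: poly_altdef degree_map_poly coeff_map_poly)
    thus ?thesis using root[OF that] by simp
  qed
  have "mset_set (complex_of_real ` S) \<subseteq># mset_set (set_mset (proots p))"
    using assms(2) root' p0 poly_roots_finite[OF p0] by (intro subset_imp_msubset_mset_set) auto
  also have "\<dots> \<subseteq># proots p" by (rule mset_set_set_mset_msubset)
  finally have sub: "mset_set (complex_of_real ` S) \<subseteq># proots p" .
  have "size (mset_set (complex_of_real ` S)) = size (proots p)"
    using assms(3) by (simp add: size_proots_complex deg card_image inj_on_def)
  with sub have eq: "proots p = mset_set (complex_of_real ` S)"
    by (metis mset_subset_size nat_neq_iff subset_mset.le_neq_trans)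
  have "z \<in> complex_of_real ` {-1..1} \<and> order z p = 1" if "poly p z = 0" for z
  proof -
    have z: "z \<in># proots p" using that p0 by simp
    hence zS: "z \<in> complex_of_real ` S" using eq assms(2) by simp
    have "order z p = count (proots p) z" using p0 by simp
    also have "\<dots> = 1" using eq zS assms(2) by simp
    finally show ?thesis using zS assms(4) by auto
  qed
  thus ?thesis using assms(1) by (simp add: simple_zero_polys_def p_def)
qed

text \<open>
The recursion is what the pullback under \<open>u\<close> amounts to: a polynomial relation between three consecutive
pullbacks is preserved by a further pullback, and this one holds at the start.  It exhibits the coefficients
as integers and governs the leading coefficients.
\<close>

fun gorshkov :: "nat \<Rightarrow> int poly" where
  "gorshkov 0 = [:-1, 2:]"
| "gorshkov (Suc 0) = [:1, -5, 5:]"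
| "gorshkov (Suc (Suc n)) = gorshkov (Suc n) ^ 2 + gorshkov (Suc n) * gorshkov n ^ 2 - gorshkov n ^ 4"

lemma degree_lead_gorshkov:
  "degree (gorshkov n) = 2 ^ n \<and> degree (gorshkov (Suc n)) = 2 ^ Suc n \<and> 0 < lead_coeff (gorshkov n) \<and>
   lead_coeff (gorshkov n) ^ 2 \<le> lead_coeff (gorshkov (Suc n))"
proof (induction n)
  case (Suc n)
  define p where "p = gorshkov n"
  define q where "q = gorshkov (Suc n)"
  define r where "r = gorshkov (Suc (Suc n))"
  define a where "a = lead_coeff p"
  define b where "b = lead_coeff q"
  have IH: "degree p = 2 ^ n" "degree q = 2 * 2 ^ n" "0 < a" "a ^ 2 \<le> b"
    using Suc.IH unfolding p_def q_def a_def b_def power_Suc by blast+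
  have r: "r = q ^ 2 + q * p ^ 2 - p ^ 4" by (simp add: p_def q_def r_def)
  have b0: "0 < b" using IH by (smt (verit) zero_less_power)
  have nz: "p \<noteq> 0" "q \<noteq> 0" using IH b0 by (auto simp: a_def b_def)
  define N where "N = 4 * (2::nat) ^ n"
  have d: "degree (q ^ 2) = N" "degree (q * p ^ 2) = N" "degree (p ^ 4) = N"
    using nz by (simp_all add: degree_power_eq degree_mult_eq IH N_def)
  have "coeff (q ^ 2) N = b ^ 2" "coeff (q * p ^ 2) N = b * a ^ 2" "coeff (p ^ 4) N = a ^ 4"
    unfolding d(1)[symmetric] d(2)[symmetric]
    by (metis d a_def b_def lead_coeff_power lead_coeff_mult)+
  hence cr: "coeff r N = b ^ 2 + b * a ^ 2 - a ^ 4" by (simp add: r)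
  have "a ^ 2 * a ^ 2 \<le> b * a ^ 2" using IH by (intro mult_right_mono) auto
  hence ge: "b ^ 2 \<le> coeff r N" unfolding cr by (simp add: power4_eq_xxxx power2_eq_square mult.assoc)
  have "degree r \<le> N" unfolding r by (intro degree_diff_le degree_add_le) (simp_all add: d)
  moreover have "N \<le> degree r" using ge b0 by (intro le_degree) auto
  ultimately have "degree r = N" by simp
  thus ?case using ge b0 IH
    unfolding p_def[symmetric] q_def[symmetric] r_def[symmetric] by (simp add: a_def b_def N_def)
qed simp_all

definition gorshkov_lead :: "nat \<Rightarrow> real" where "gorshkov_lead n = real_of_int (lead_coeff (gorshkov n))"

lemma degree_gorshkov: "degree (gorshkov n) = 2 ^ n" using degree_lead_gorshkov by blast
lemma gorshkov_lead_pos: "gorshkov_lead n > 0" using degree_lead_gorshkov[of n] unfolding gorshkov_lead_def by (metis of_int_0_less_iff)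
lemma gorshkov_lead_square_le: "gorshkov_lead n ^ 2 \<le> gorshkov_lead (Suc n)"
  using degree_lead_gorshkov[of n] unfolding gorshkov_lead_def by (metis of_int_le_iff of_int_power)

lemma gorshkov_lead_rec: "gorshkov_lead (Suc (Suc n)) = gorshkov_lead (Suc n) ^ 2 + gorshkov_lead (Suc n) * gorshkov_lead n ^ 2 - gorshkov_lead n ^ 4"
proof -
  define p where "p = gorshkov n"
  define q where "q = gorshkov (Suc n)"
  have nz: "p \<noteq> 0" "q \<noteq> 0" using degree_gorshkov[of n] degree_gorshkov[of "Suc n"] by (auto simp: p_def q_def)
  define N where "N = 4 * (2::nat) ^ n"
  have d: "degree (q ^ 2) = N" "degree (q * p ^ 2) = N" "degree (p ^ 4) = N"
    using nz by (simp_all add: degree_power_eq degree_mult_eq p_def q_def degree_gorshkov N_def)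
  have "coeff (q ^ 2) N = lead_coeff q ^ 2" "coeff (q * p ^ 2) N = lead_coeff q * lead_coeff p ^ 2"
    "coeff (p ^ 4) N = lead_coeff p ^ 4"
    unfolding d(1)[symmetric] d(2)[symmetric]
    by (metis d lead_coeff_power lead_coeff_mult)+
  moreover have "lead_coeff (gorshkov (Suc (Suc n))) = coeff (q ^ 2 + q * p ^ 2 - p ^ 4) N"
    using degree_gorshkov[of "Suc (Suc n)"] by (simp add: N_def p_def q_def)
  ultimately show ?thesis by (simp add: gorshkov_lead_def p_def q_def)
qed

abbreviation gorshkov_fun :: "nat \<Rightarrow> real \<Rightarrow> real" where "gorshkov_fun n x \<equiv> poly (map_poly of_int (gorshkov n)) x"

lemma gorshkov_fun_simps:
  "gorshkov_fun 0 x = 2 * x - 1" "gorshkov_fun (Suc 0) x = 1 - 5 * x * (1 - x)"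
  "gorshkov_fun (Suc (Suc n)) x = gorshkov_fun (Suc n) x ^ 2 + gorshkov_fun (Suc n) x * gorshkov_fun n x ^ 2 - gorshkov_fun n x ^ 4"
proof -
  show "gorshkov_fun 0 x = 2 * x - 1" "gorshkov_fun (Suc 0) x = 1 - 5 * x * (1 - x)"
    by (simp_all add: algebra_simps map_poly_pCons)
  show "gorshkov_fun (Suc (Suc n)) x = gorshkov_fun (Suc n) x ^ 2 + gorshkov_fun (Suc n) x * gorshkov_fun n x ^ 2 - gorshkov_fun n x ^ 4"
    by (simp add: of_int_poly_hom.hom_add of_int_poly_hom.hom_minus of_int_poly_hom.hom_mult of_int_poly_hom.hom_power)
qed

text \<open>
For \<open>n = 0\<close> only the squares agree: the pullback of \<open>2x - 1\<close> is the negative of the next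
polynomial.  Squares suffice for the induction, since the recursion contains the older polynomial only in even powers.
\<close>

lemma gorshkov_functional_equation:
  fixes x :: real
  defines "D \<equiv> 1 - 3 * x * (1 - x)"
  assumes "D \<noteq> 0"
  shows "gorshkov_fun (Suc n) x ^ 2 = (D ^ 2 ^ n * gorshkov_fun n (x * (1 - x) / D)) ^ 2 \<and>
         gorshkov_fun (Suc (Suc n)) x = D ^ 2 ^ Suc n * gorshkov_fun (Suc n) (x * (1 - x) / D)"
proof (induction n)
  case 0
  define u where "u = x * (1 - x) / D"
  have uD: "x * (1 - x) = u * D" using assms(2) by (simp add: u_def)
  have "D = 1 - 3 * (x * (1 - x))" by (simp add: D_def)
  hence D: "D = 1 - 3 * (u * D)" by (simp only: uD)
  have 1: "gorshkov_fun (Suc 0) x ^ 2 = (D * (2 * u - 1)) ^ 2"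
  proof -
    have "gorshkov_fun (Suc 0) x = 1 - 5 * (u * D)" unfolding uD[symmetric] gorshkov_fun_simps(2) by simp
    also have "\<dots> = - (D * (2 * u - 1))" using D by (simp add: algebra_simps)
    finally show ?thesis by simp
  qed
  have "gorshkov_fun (Suc (Suc 0)) x = D ^ 2 * gorshkov_fun (Suc 0) u"
  proof -
    have "(2 * x - 1) ^ 2 = 1 - 4 * (u * D)"
      unfolding uD[symmetric] by (simp add: power2_eq_square algebra_simps)
    also have "\<dots> = D - u * D" using D by linarith
    finally have s: "(2 * x - 1) ^ 2 = D - u * D" .
    have "gorshkov_fun (Suc 0) x = 1 - 5 * (u * D)" unfolding uD[symmetric] gorshkov_fun_simps(2) by simp
    also have "\<dots> = D - 2 * (u * D)" using D by linarith
    finally have f: "gorshkov_fun (Suc 0) x = D - 2 * (u * D)" .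
    have "gorshkov_fun (Suc (Suc 0)) x = (D - 2 * (u * D)) ^ 2 + (D - 2 * (u * D)) * (D - u * D) - (D - u * D) ^ 2"
      unfolding gorshkov_fun_simps(3) f s[symmetric] gorshkov_fun_simps(1) by (simp add: power4_eq_xxxx power2_eq_square)
    also have "\<dots> = D ^ 2 * gorshkov_fun (Suc 0) u"
      unfolding gorshkov_fun_simps by (simp add: power2_eq_square algebra_simps)
    finally show ?thesis .
  qed
  moreover have "gorshkov_fun (Suc 0) x ^ 2 = (D * gorshkov_fun 0 u) ^ 2" using 1 by (simp only: gorshkov_fun_simps(1))
  ultimately show ?case unfolding u_def by (simp del: gorshkov.simps)
next
  case (Suc n)
  let ?u = "x * (1 - x) / D"
  have 1: "gorshkov_fun (Suc (Suc n)) x = D ^ 2 ^ Suc n * gorshkov_fun (Suc n) ?u"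
    and 2: "gorshkov_fun (Suc n) x ^ 2 = (D ^ 2 ^ n * gorshkov_fun n ?u) ^ 2" using Suc by auto
  have 3: "gorshkov_fun (Suc n) x ^ 4 = (D ^ 2 ^ n * gorshkov_fun n ?u) ^ 4"
    using arg_cong[OF 2, of "\<lambda>y. y ^ 2"] by (simp add: power_mult[symmetric] del: power_mult_distrib)
  define E where "E = D ^ 2 ^ n"
  have E: "D ^ 2 ^ Suc n = E ^ 2" "D ^ 2 ^ Suc (Suc n) = E ^ 4"
    by (simp_all add: E_def power_mult[symmetric] mult.commute)
  have "gorshkov_fun (Suc (Suc (Suc n))) x = D ^ 2 ^ Suc (Suc n) * gorshkov_fun (Suc (Suc n)) ?u"
    unfolding gorshkov_fun_simps(3)[of "Suc n"] gorshkov_fun_simps(3)[of n ?u] 1 2 3 E E_def[symmetric]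
    by (simp add: power_mult_distrib algebra_simps power_mult[symmetric] power4_eq_xxxx power2_eq_square)
  thus ?case using 1 by simp
qed

text \<open>
Solving \<open>u(x) = y\<close> gives \<open>x(1-x) = y/(1+3y)\<close>, hence \<open>x = (1 \<plusminus> s)/2\<close> with \<open>s\<^sup>2 = (1-y)/(1+3y)\<close>.
\<close>

lemma gorshkov_root_preimage:
  fixes y s :: real
  assumes y: "0 < y" "y < 1" and s: "s ^ 2 = (1 - y) / (1 + 3 * y)" and root: "gorshkov_fun n y = 0"
  shows "gorshkov_fun (Suc n) ((1 + s) / 2) = 0" "s \<noteq> 0" "\<bar>s\<bar> < 1"
proof -
  define x where "x = (1 + s) / 2"
  define D where "D = 1 - 3 * x * (1 - x)"
  have N: "x * (1 - x) = y / (1 + 3 * y)"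
  proof -
    have "x * (1 - x) = (1 - s ^ 2) / 4" by (simp add: x_def field_simps power2_eq_square)
    also have "\<dots> = y / (1 + 3 * y)" unfolding s using y by (simp add: field_simps)
    finally show ?thesis .
  qed
  have "D = 1 - 3 * (x * (1 - x))" by (simp add: D_def)
  hence D: "D = 1 / (1 + 3 * y)" unfolding N using y by (simp add: field_simps)
  have D0: "D \<noteq> 0" unfolding D using y by simp
  have u: "x * (1 - x) / D = y" unfolding N D using y by simp
  have "gorshkov_fun (Suc n) x ^ 2 = (D ^ 2 ^ n * gorshkov_fun n (x * (1 - x) / D)) ^ 2"
    using gorshkov_functional_equation[of x n] D0 unfolding D_def by blast
  thus "gorshkov_fun (Suc n) ((1 + s) / 2) = 0" by (simp add: u root x_def[symmetric])
  show "s \<noteq> 0" using s y by auto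
  have "s ^ 2 < 1" unfolding s using y by (simp add: field_simps)
  thus "\<bar>s\<bar> < 1" by (simp add: abs_square_less_1)
qed

lemma gorshkov_roots:
  "\<exists>S. finite S \<and> card S = 2 ^ n \<and> S \<subseteq> {0<..<1} \<and> (\<forall>x\<in>S. gorshkov_fun n x = 0)"
proof (induction n)
  case 0
  have "gorshkov_fun 0 (1/2) = 0" by (simp add: gorshkov_fun_simps)
  thus ?case by (intro exI[of _ "{1/2}"]) auto
next
  case (Suc n)
  then obtain S where S: "finite S" "card S = 2 ^ n" "S \<subseteq> {0<..<1}" "\<And>x. x \<in> S \<Longrightarrow> gorshkov_fun n x = 0"
    by blast
  define s where "s y = sqrt ((1 - y) / (1 + 3 * y))" for y :: real
  have s: "s y ^ 2 = (1 - y) / (1 + 3 * y)" "s y > 0" if "y \<in> S" for y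
    using S(3) that by (force simp: s_def)+
  have inj: "inj_on s S"
  proof (rule inj_onI)
    fix y z assume yz: "y \<in> S" "z \<in> S" "s y = s z"
    hence "(1 - y) / (1 + 3 * y) = (1 - z) / (1 + 3 * z)" using s by metis
    moreover have "1 + 3 * y > 0" "1 + 3 * z > 0" using yz S(3) by force+
    ultimately show "y = z" by (simp add: field_simps)
  qed
  define T where "T = (\<lambda>y. (1 + s y) / 2) ` S \<union> (\<lambda>y. (1 - s y) / 2) ` S"
  have "card T = card ((\<lambda>y. (1 + s y) / 2) ` S) + card ((\<lambda>y. (1 - s y) / 2) ` S)"
    unfolding T_def using S(1) by (intro card_Un_disjoint) (auto dest!: s(2))
  also have "card ((\<lambda>y. (1 + s y) / 2) ` S) = card S"
    using inj by (intro card_image) (auto simp: inj_on_def)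
  also have "card ((\<lambda>y. (1 - s y) / 2) ` S) = card S"
    using inj by (intro card_image) (auto simp: inj_on_def)
  finally have "card T = 2 ^ Suc n" using S(2) by simp
  moreover have "finite T" using S(1) by (simp add: T_def)
  moreover have "x \<in> {0<..<1} \<and> gorshkov_fun (Suc n) x = 0" if "x \<in> T" for x
  proof -
    from that have "\<exists>y\<in>S. x = (1 + s y) / 2 \<or> x = (1 + - s y) / 2" by (auto simp: T_def)
    then obtain y t where y: "y \<in> S" "t = s y \<or> t = - s y" "x = (1 + t) / 2" by metis
    have "t ^ 2 = (1 - y) / (1 + 3 * y)" using y(2) s[OF y(1)] by auto
    from gorshkov_root_preimage[OF _ _ this S(4)[OF y(1)]] S(3) y(1)
    have "gorshkov_fun (Suc n) ((1 + t) / 2) = 0" "\<bar>t\<bar> < 1" by auto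
    thus ?thesis by (auto simp: y(3) abs_less_iff)
  qed
  ultimately show ?case by blast
qed

definition gorshkov_sq :: "nat \<Rightarrow> int poly" where "gorshkov_sq n = pcompose (gorshkov n) [:0, 0, 1:]"

lemma degree_gorshkov_sq: "degree (gorshkov_sq n) = 2 ^ Suc n"
  by (simp add: gorshkov_sq_def degree_gorshkov)

lemma lead_coeff_gorshkov_sq: "lead_coeff (gorshkov_sq n) = lead_coeff (gorshkov n)"
  unfolding gorshkov_sq_def by (subst lead_coeff_comp) simp_all

lemma gorshkov_sq_in_simple_zero_polys: "gorshkov_sq n \<in> simple_zero_polys (2 ^ Suc n) (complex_of_real ` {-1..1})"
proof -
  obtain S where S: "finite S" "card S = 2 ^ n" "S \<subseteq> {0<..<1}" "\<And>x. x \<in> S \<Longrightarrow> gorshkov_fun n x = 0"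
    using gorshkov_roots by metis
  define T where "T = sqrt ` S \<union> (\<lambda>x. - sqrt x) ` S"
  have "card T = card (sqrt ` S) + card ((\<lambda>x. - sqrt x) ` S)"
    unfolding T_def using S
    by (intro card_Un_disjoint) (auto, smt (verit) S(3) greaterThanLessThan_iff real_sqrt_gt_zero subsetD)
  also have "card (sqrt ` S) = card S" by (intro card_image) (auto simp: inj_on_def)
  also have "card ((\<lambda>x. - sqrt x) ` S) = card S" by (intro card_image) (auto simp: inj_on_def)
  finally have card: "card T = degree (gorshkov_sq n)" using S(2) by (simp add: degree_gorshkov_sq)
  have "finite T" using S(1) by (simp add: T_def)
  moreover have "T \<subseteq> {-1..1}"
  proof -
    have "sqrt x \<in> {-1..1} \<and> - sqrt x \<in> {-1..1}" if "x \<in> S" for x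
    proof -
      have "0 < sqrt x" "sqrt x < 1" using that S(3) by auto
      thus ?thesis unfolding atLeastAtMost_iff by linarith
    qed
    thus ?thesis unfolding T_def by blast
  qed
  moreover have "poly (map_poly of_int (gorshkov_sq n)) x = 0" if "x \<in> T" for x :: real
  proof -
    have "x ^ 2 \<in> S" using that S(3) by (force simp: T_def)
    moreover have "poly (map_poly of_int (gorshkov_sq n)) x = gorshkov_fun n (x ^ 2)"
      by (simp add: gorshkov_sq_def of_int_hom.map_poly_pcompose poly_pcompose map_poly_pCons power2_eq_square)
    ultimately show ?thesis using S(4) by simp
  qed
  moreover have "gorshkov_sq n \<noteq> 0" using degree_gorshkov_sq[of n] by auto
  ultimately have "gorshkov_sq n \<in> simple_zero_polys (degree (gorshkov_sq n)) (complex_of_real ` {-1..1})"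
    using card by (intro simple_zero_polysI)
  thus ?thesis by (simp only: degree_gorshkov_sq)
qed

section \<open>Growth of the Gorshkov leading coefficients and the upper bound\<close>

text \<open>
The quotients \<open>r\<^sub>k = a\<^bsub>k+1\<^esub>/a\<^sub>k\<^sup>2\<close> of the leading coefficients decrease to 1, and \<open>ln a\<^sub>n / 2\<^sup>n\<close> equals
\<open>ln a\<^sub>0\<close> plus the sum of the \<open>ln r\<^sub>k / 2\<^bsup>k+1\<^esup>\<close> for \<open>k < n\<close>; so the growth rate converges fast.
\<close>

definition lead_ratio :: "nat \<Rightarrow> real" where "lead_ratio n = gorshkov_lead (Suc n) / gorshkov_lead n ^ 2"

lemma lead_ratio_ge_1: "lead_ratio n \<ge> 1"
  using gorshkov_lead_square_le[of n] gorshkov_lead_pos[of n] by (simp add: lead_ratio_def)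

lemma lead_ratio_Suc: "lead_ratio (Suc n) = 1 + 1 / lead_ratio n - 1 / lead_ratio n ^ 2"
  using gorshkov_lead_pos[of n] gorshkov_lead_pos[of "Suc n"]
  unfolding lead_ratio_def gorshkov_lead_rec[of n] by (simp add: field_simps power2_eq_square power4_eq_xxxx)

lemma lead_ratio_Suc_le: "lead_ratio (Suc n) \<le> lead_ratio n"
proof -
  define r where "r = lead_ratio n"
  have r: "r \<ge> 1" using lead_ratio_ge_1 by (simp add: r_def)
  have "r - lead_ratio (Suc n) = (r - 1) ^ 2 * (r + 1) / r ^ 2"
    unfolding lead_ratio_Suc r_def[symmetric] using r by (simp add: field_simps power2_eq_square)
  moreover have "(r - 1) ^ 2 * (r + 1) / r ^ 2 \<ge> 0" using r by simp
  ultimately show ?thesis by (simp add: r_def)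
qed

lemma ratio_map_mono:
  fixes r s :: real
  assumes "1 \<le> r" "r \<le> s" "s \<le> 2"
  shows "1 + 1 / r - 1 / r ^ 2 \<le> 1 + 1 / s - 1 / s ^ 2"
proof -
  have "(1 / s - 1 / s ^ 2) - (1 / r - 1 / r ^ 2) = (1 / r - 1 / s) * (1 / r + 1 / s - 1)"
    using assms by (simp add: field_simps power2_eq_square)
  moreover have "1 / r - 1 / s \<ge> 0" using assms by (simp add: field_simps)
  moreover have "1 / r + 1 / s - 1 \<ge> 0" 
  proof -
    have "1 / r \<ge> 1 / 2" "1 / s \<ge> 1 / 2" using assms by (simp_all add: field_simps)
    thus ?thesis by linarith
  qed
  ultimately show ?thesis by (smt (verit) mult_nonneg_nonneg)
qed

text \<open>
The number \<open>\<gamma>\<close> measures how far the leading coefficient stays below the target \<open>C\<^bsup>2^(n+1)\<^esup>\<close>.  Passing to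
the next index squares it and divides it by the next quotient.
\<close>

definition growth_cert :: "real \<Rightarrow> nat \<Rightarrow> real \<Rightarrow> real \<Rightarrow> bool" where
  "growth_cert C n \<rho> \<gamma> \<longleftrightarrow> lead_ratio n \<le> \<rho> \<and> gorshkov_lead (Suc n) * \<gamma> \<le> C ^ 2 ^ Suc n"

lemma growth_cert_step:
  assumes "growth_cert C n \<rho> \<gamma>" "\<rho> \<le> 2" "1 + 1 / \<rho> - 1 / \<rho> ^ 2 \<le> \<rho>'" "0 \<le> \<gamma>" "0 \<le> \<gamma>'" "\<gamma>' * \<rho>' \<le> \<gamma> ^ 2"
  shows "growth_cert C (Suc n) \<rho>' \<gamma>'"
proof -
  have r: "lead_ratio (Suc n) \<le> \<rho>'"
    using ratio_map_mono[of "lead_ratio n" \<rho>] lead_ratio_ge_1[of n] assms(1-3) unfolding lead_ratio_Suc growth_cert_def by linarith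
  have "gorshkov_lead (Suc (Suc n)) * \<gamma>' = gorshkov_lead (Suc n) ^ 2 * (lead_ratio (Suc n) * \<gamma>')"
    using gorshkov_lead_pos[of "Suc n"] by (simp add: lead_ratio_def)
  also have "\<dots> \<le> gorshkov_lead (Suc n) ^ 2 * (\<gamma>' * \<rho>')"
    using r assms(5) by (intro mult_left_mono) (auto simp: mult.commute intro: mult_left_mono)
  also have "\<dots> \<le> gorshkov_lead (Suc n) ^ 2 * \<gamma> ^ 2" using assms(6) by (intro mult_left_mono) auto
  also have "\<dots> = (gorshkov_lead (Suc n) * \<gamma>) ^ 2" by (simp add: power_mult_distrib)
  also have "\<dots> \<le> (C ^ 2 ^ Suc n) ^ 2"
    using assms(1,4) gorshkov_lead_pos[of "Suc n"] by (intro power_mono) (auto simp: growth_cert_def)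
  also have "\<dots> = C ^ 2 ^ Suc (Suc n)" by (simp add: power_mult[symmetric] mult.commute)
  finally show ?thesis using r by (simp add: growth_cert_def)
qed

text \<open>
Once the reserve \<open>\<gamma>\<close> exceeds the current quotient, it suffices for all later indices, because the quotients
decrease: \<open>a\<^sub>k r\<^sub>n\<close> is at most squared when \<open>k\<close> increases by one.
\<close>

lemma growth_cert_finish:
  assumes "growth_cert C n \<rho> \<gamma>" "\<rho> \<le> \<gamma>" "k \<ge> Suc n"
  shows "gorshkov_lead k \<le> C ^ 2 ^ k"
proof -
  have "gorshkov_lead k * lead_ratio n \<le> C ^ 2 ^ k" using assms(3)
  proof (induction k rule: dec_induct)
    case base
    have "gorshkov_lead (Suc n) * lead_ratio n \<le> gorshkov_lead (Suc n) * \<gamma>"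
      using assms gorshkov_lead_pos[of "Suc n"] by (intro mult_left_mono) (auto simp: growth_cert_def)
    thus ?case using assms(1) by (simp add: growth_cert_def)
  next
    case (step k)
    have "lead_ratio k \<le> lead_ratio n"
      using step.hyps by (intro lift_Suc_antimono_le[of lead_ratio, OF lead_ratio_Suc_le]) auto
    have "gorshkov_lead (Suc k) * lead_ratio n = gorshkov_lead k ^ 2 * (lead_ratio k * lead_ratio n)"
      using gorshkov_lead_pos[of k] by (simp add: lead_ratio_def)
    also have "\<dots> \<le> gorshkov_lead k ^ 2 * (lead_ratio n * lead_ratio n)"
      using \<open>lead_ratio k \<le> lead_ratio n\<close> lead_ratio_ge_1[of n] by (intro mult_left_mono mult_right_mono) auto
    also have "\<dots> = (gorshkov_lead k * lead_ratio n) ^ 2" by (simp add: power2_eq_square)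
    also have "\<dots> \<le> (C ^ 2 ^ k) ^ 2"
      using step.IH gorshkov_lead_pos[of k] lead_ratio_ge_1[of n] by (intro power_mono) auto
    also have "\<dots> = C ^ 2 ^ Suc k" by (simp add: power_mult[symmetric] mult.commute)
    finally show ?case .
  qed
  moreover have "gorshkov_lead k * 1 \<le> gorshkov_lead k * lead_ratio n"
    using gorshkov_lead_pos[of k] lead_ratio_ge_1[of n] by (intro mult_left_mono) auto
  ultimately show ?thesis by simp
qed

lemma ratio_map_le_scaled:
  fixes T r r' :: real
  assumes "T > 0" "r > 0" "T * (r\<^sup>2 + T * r - T\<^sup>2) \<le> r' * r\<^sup>2"
  shows "1 + 1 / (r / T) - 1 / (r / T)\<^sup>2 \<le> r' / T"
proof -
  have "1 + 1 / (r / T) - 1 / (r / T)\<^sup>2 = T * (r\<^sup>2 + T * r - T\<^sup>2) / (T * r\<^sup>2)"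
    using assms(1,2) by (simp add: field_simps power2_eq_square)
  also have "\<dots> \<le> r' * r\<^sup>2 / (T * r\<^sup>2)"
    using assms by (intro divide_right_mono) simp_all
  also have "\<dots> = r' / T" using assms(2) by simp
  finally show ?thesis .
qed

lemma growth_cert_step_int:
  fixes r g r' g' :: int
  assumes "growth_cert C n (of_int r / 10 ^ 14) (of_int g / 10 ^ 14)"
    and "0 < r" "r \<le> 2 * 10 ^ 14" "10 ^ 14 * (r\<^sup>2 + 10 ^ 14 * r - 10 ^ 28) \<le> r' * r\<^sup>2"
    and "0 \<le> g" "0 \<le> g'" "g' * r' \<le> g\<^sup>2"
  shows "growth_cert C (Suc n) (of_int r' / 10 ^ 14) (of_int g' / 10 ^ 14)"
proof (rule growth_cert_step[OF assms(1)])
  have "of_int r \<le> (of_int (2 * 10 ^ 14) :: real)" using assms(3) unfolding of_int_le_iff .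
  thus "of_int r / 10 ^ 14 \<le> (2::real)" by simp
  have "of_int (10 ^ 14 * (r\<^sup>2 + 10 ^ 14 * r - 10 ^ 28)) \<le> (of_int (r' * r\<^sup>2) :: real)"
    using assms(4) unfolding of_int_le_iff .
  thus "1 + 1 / (of_int r / 10 ^ 14) - 1 / (of_int r / 10 ^ 14)\<^sup>2 \<le> (of_int r' / 10 ^ 14 :: real)"
    using assms(2) by (intro ratio_map_le_scaled) simp_all
  have "of_int (g' * r') \<le> (of_int (g\<^sup>2) :: real)" using assms(7) unfolding of_int_le_iff .
  thus "of_int g' / 10 ^ 14 * (of_int r' / 10 ^ 14) \<le> (of_int g / 10 ^ 14 :: real)\<^sup>2"
    by (simp add: power_divide)
qed (use assms in simp_all)

text \<open>
The reserve starts as \<open>C\<^sup>2/5\<close> and the certificate is advanced until it exceeds the quotient.  Each step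
rounds the quotient up and the reserve down to 14 decimals; a relative error doubles in every step,
which still leaves the final comparison correct.
\<close>

lemma gorshkov_lead_bound: "\<exists>n. \<forall>k\<ge>n. gorshkov_lead k \<le> (1.54170092\<^sup>2) ^ 2 ^ k"
proof -
  define C :: real where "C = 1.54170092\<^sup>2"
  have "lead_ratio 0 = 5 / 4" "gorshkov_lead (Suc 0) = 5" by (simp_all add: lead_ratio_def gorshkov_lead_def)
  hence "growth_cert C 0 (of_int 125000000000000 / 10 ^ 14) (of_int 112987531878387 / 10 ^ 14)"
    by (simp add: growth_cert_def C_def power_divide)
  from growth_cert_step_int[OF this, of 116000000000000 110053296206633]
  have "growth_cert C (Suc 0) (of_int 116000000000000 / 10 ^ 14) (of_int 110053296206633 / 10 ^ 14)" by simp
  from growth_cert_step_int[OF this, of 111890606420928 108246155717317]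
  have "growth_cert C (Suc (Suc 0)) (of_int 111890606420928 / 10 ^ 14) (of_int 108246155717317 / 10 ^ 14)" by simp
  from growth_cert_step_int[OF this, of 109497662852168 107008952724379]
  have "growth_cert C (Suc (Suc (Suc 0))) (of_int 109497662852168 / 10 ^ 14) (of_int 107008952724379 / 10 ^ 14)" by simp
  from growth_cert_step_int[OF this, of 107921493128069 106104128392476]
  have "growth_cert C (Suc (Suc (Suc (Suc 0)))) (of_int 107921493128069 / 10 ^ 14) (of_int 106104128392476 / 10 ^ 14)" by simp
  from growth_cert_step_int[OF this, of 106801287902538 105411519683176]
  have "growth_cert C (Suc (Suc (Suc (Suc (Suc 0))))) (of_int 106801287902538 / 10 ^ 14) (of_int 105411519683176 / 10 ^ 14)" by simp
  from growth_cert_step_int[OF this, of 105962634375459 104863271354171]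
  have "growth_cert C (Suc (Suc (Suc (Suc (Suc (Suc 0)))))) (of_int 105962634375459 / 10 ^ 14) (of_int 104863271354171 / 10 ^ 14)" by simp
  from growth_cert_step_int[OF this, of 105310466648950 104417975050423]
  have "growth_cert C (Suc (Suc (Suc (Suc (Suc (Suc (Suc 0))))))) (of_int 105310466648950 / 10 ^ 14) (of_int 104417975050423 / 10 ^ 14)" by simp
  from growth_cert_step_int[OF this, of 104788391059971 104048868422751]
  have "growth_cert C (Suc (Suc (Suc (Suc (Suc (Suc (Suc (Suc 0)))))))) (of_int 104788391059971 / 10 ^ 14) (of_int 104048868422751 / 10 ^ 14)" by simp
  from growth_cert_step_int[OF this, of 104360770860090 103737898166437]
  have "growth_cert C (Suc (Suc (Suc (Suc (Suc (Suc (Suc (Suc (Suc 0))))))))) (of_int 104360770860090 / 10 ^ 14) (of_int 103737898166437 / 10 ^ 14)" by simp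
  from growth_cert_step_int[OF this, of 104003950596759 103472526324643]
  have "growth_cert C (Suc (Suc (Suc (Suc (Suc (Suc (Suc (Suc (Suc (Suc 0)))))))))) (of_int 104003950596759 / 10 ^ 14) (of_int 103472526324643 / 10 ^ 14)" by simp
  from growth_cert_step_int[OF this, of 103701596174089 103243962475083]
  have "growth_cert C (Suc (Suc (Suc (Suc (Suc (Suc (Suc (Suc (Suc (Suc (Suc 0))))))))))) (of_int 103701596174089 / 10 ^ 14) (of_int 103243962475083 / 10 ^ 14)" by simp
  from growth_cert_step_int[OF this, of 103442057772813 103046246537043]
  have "growth_cert C (Suc (Suc (Suc (Suc (Suc (Suc (Suc (Suc (Suc (Suc (Suc (Suc 0)))))))))))) (of_int 103442057772813 / 10 ^ 14) (of_int 103046246537043 / 10 ^ 14)" by simp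
  from growth_cert_step_int[OF this, of 103216798463546 102875976424741]
  have "growth_cert C (Suc (Suc (Suc (Suc (Suc (Suc (Suc (Suc (Suc (Suc (Suc (Suc (Suc 0))))))))))))) (of_int 103216798463546 / 10 ^ 14) (of_int 102875976424741 / 10 ^ 14)" by simp
  from growth_cert_step_int[OF this, of 103019416919468 102732735651349]
  have "growth_cert C (Suc (Suc (Suc (Suc (Suc (Suc (Suc (Suc (Suc (Suc (Suc (Suc (Suc (Suc 0)))))))))))))) (of_int 103019416919468 / 10 ^ 14) (of_int 102732735651349 / 10 ^ 14)" by simp
  from growth_cert_step_int[OF this, of 102845017285223 102620576601588]
  have "growth_cert C (Suc (Suc (Suc (Suc (Suc (Suc (Suc (Suc (Suc (Suc (Suc (Suc (Suc (Suc (Suc 0))))))))))))))) (of_int 102845017285223 / 10 ^ 14) (of_int 102620576601588 / 10 ^ 14)" by simp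
  from growth_cert_step_int[OF this, of 102689790146681 102551409706846]
  have "growth_cert C (Suc (Suc (Suc (Suc (Suc (Suc (Suc (Suc (Suc (Suc (Suc (Suc (Suc (Suc (Suc (Suc 0)))))))))))))))) (of_int 102689790146681 / 10 ^ 14) (of_int 102551409706846 / 10 ^ 14)" by simp
  from growth_cert_step_int[OF this, of 102550726332451 102552093085794]
  have "growth_cert C (Suc (Suc (Suc (Suc (Suc (Suc (Suc (Suc (Suc (Suc (Suc (Suc (Suc (Suc (Suc (Suc (Suc 0))))))))))))))))) (of_int 102550726332451 / 10 ^ 14) (of_int 102552093085794 / 10 ^ 14)" by simp
  from growth_cert_finish[OF this] show ?thesis unfolding C_def by auto
qed

text \<open>
The product of the \<open>j x - 1\<close> for \<open>1 \<le> j \<le> n\<close> is an example.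
\<close>

lemma simple_zero_polys_nonempty: "\<exists>P. P \<in> simple_zero_polys n (complex_of_real ` {-1..1})"
proof -
  define P :: "int poly" where "P = (\<Prod>j=1..n. [:-1, int j:])"
  define S where "S = (\<lambda>j. 1 / real j) ` {1..n}"
  have P0: "P \<noteq> 0" by (auto simp: P_def)
  have "degree P = (\<Sum>j=1..n. degree [:-1, int j:])"
    unfolding P_def by (intro degree_prod_eq_sum_degree) auto
  also have "\<dots> = (\<Sum>j=1..n. 1)" by (intro sum.cong) auto
  finally have deg: "degree P = n" by simp
  have "card S = n" unfolding S_def by (subst card_image) (auto simp: inj_on_def)
  moreover have "poly (map_poly of_int P) x = 0" if "x \<in> S" for x :: real
    using that by (auto simp: P_def S_def of_int_poly_hom.hom_prod poly_prod map_poly_pCons)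
  ultimately have "P \<in> simple_zero_polys (degree P) (complex_of_real ` {-1..1})"
    using P0 deg by (intro simple_zero_polysI[of _ S]) (auto simp: S_def field_simps)
  thus ?thesis using deg by auto
qed

text \<open>
The degrees \<open>2\<^bsup>k+1\<^esup>\<close> carry the Gorshkov polynomials in \<open>x\<^sup>2\<close>.  The values along this subsequence
eventually stay below the bound, which is all that a limit inferior requires.
\<close>

theorem upper_bound: "min_leading_growth (complex_of_real ` {-1..1}) \<le> ereal 1.54170092"
proof -
  define E where "E = complex_of_real ` {-1..1}"
  obtain R where R: "\<And>n. R n \<in> simple_zero_polys n E" using simple_zero_polys_nonempty unfolding E_def by metis
  define P where "P n = (if \<exists>k. n = 2 ^ Suc k then gorshkov_sq (THE k. n = 2 ^ Suc k) else R n)" for n :: nat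
  have P: "P (2 ^ Suc k) = gorshkov_sq k" for k
    by (auto simp: P_def)
  have in_E: "P n \<in> simple_zero_polys n E" for n
    using R gorshkov_sq_in_simple_zero_polys by (auto simp: P_def E_def)
  define f where "f n = ereal (root n \<bar>real_of_int (lead_coeff (P n))\<bar>)" for n
  obtain K where K: "\<And>k. k \<ge> K \<Longrightarrow> gorshkov_lead k \<le> (1.54170092\<^sup>2) ^ 2 ^ k" using gorshkov_lead_bound by blast
  have f_le: "f (2 ^ Suc k) \<le> ereal 1.54170092" if "k \<ge> K" for k
  proof -
    have "gorshkov_lead k \<le> 1.54170092 ^ 2 ^ Suc k" using K[OF that] by (simp add: power_mult)
    hence "root (2 ^ Suc k) (gorshkov_lead k) \<le> root (2 ^ Suc k) (1.54170092 ^ 2 ^ Suc k)"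
      by (intro real_root_le_mono) auto
    also have "\<dots> = 1.54170092" by (rule real_root_power_cancel) auto
    finally show ?thesis
      using gorshkov_lead_pos[of k] by (simp add: f_def P lead_coeff_gorshkov_sq gorshkov_lead_def del: power_Suc)
  qed
  have "liminf f \<le> ereal 1.54170092"
  proof (rule ccontr)
    assume "\<not> liminf f \<le> ereal 1.54170092"
    hence "eventually (\<lambda>n. f n > ereal 1.54170092) sequentially"
      by (intro less_LiminfD) auto
    then obtain N where N: "\<And>n. n \<ge> N \<Longrightarrow> f n > ereal 1.54170092"
      by (auto simp: eventually_sequentially)
    define k where "k = max K N"
    have "N \<le> 2 ^ Suc k" using less_exp[of "Suc k"] by (simp add: k_def)
    with N f_le[of k] show False by (force simp: k_def)
  qed
  moreover have "min_leading_growth E \<le> liminf f"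
    unfolding min_leading_growth_def f_def using in_E by (intro INF_lower) auto
  ultimately show ?thesis unfolding E_def by (rule order_trans[rotated])
qed

section \<open>Tangent bounds for logarithms of real-rooted polynomials\<close>

text \<open>
For a real-rooted polynomial \<open>p\<close>, \<open>ln \<bar>p\<bar>\<close> is a sum of functions \<open>ln \<bar>t - r\<bar>\<close>, each concave on either side
of its root \<open>r\<close>.  The tangent at a point \<open>e\<close> therefore bounds it at every \<open>t\<close> not separated from \<open>e\<close> by a root.
\<close>

definition splits_over :: "real poly \<Rightarrow> real set \<Rightarrow> bool" where
  "splits_over p S \<longleftrightarrow> finite S \<and> p = smult (lead_coeff p) (\<Prod>r\<in>S. [:-r, 1:])"

text \<open>
The difference of the two sides has smaller degree than \<open>p\<close> but vanishes at all points of \<open>S\<close>.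
\<close>

lemma splits_overI:
  fixes p :: "real poly"
  assumes "p \<noteq> 0" "finite S" "card S = degree p" "\<And>r. r \<in> S \<Longrightarrow> poly p r = 0"
  shows "splits_over p S"
proof -
  define q where "q = (\<Prod>r\<in>S. [:-r, 1:])"
  have degq: "degree q = card S"
    unfolding q_def by (subst degree_prod_eq_sum_degree) auto
  have lq: "lead_coeff q = 1" unfolding q_def by (simp add: lead_coeff_prod)
  define d where "d = p - smult (lead_coeff p) q"
  have root: "poly d r = 0" if "r \<in> S" for r
    using assms(2,4) that by (auto simp: d_def q_def poly_prod intro!: prod_zero)
  have "d = 0"
  proof (rule ccontr)
    assume d: "d \<noteq> 0"
    have "degree d \<le> degree p" unfolding d_def
      using assms(3) degq by (intro degree_diff_le) auto
    moreover have "coeff d (degree p) = 0"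
      using lq degq assms(3) by (simp add: d_def)
    ultimately have "degree d < degree p"
      using d by (metis le_neq_implies_less leading_coeff_0_iff)
    moreover have "card S \<le> card {x. poly d x = 0}"
      using root d poly_roots_finite by (intro card_mono) auto
    ultimately show False using card_poly_roots_bound[OF d] assms(3) by linarith
  qed
  thus ?thesis using assms(2) by (simp add: splits_over_def d_def q_def)
qed

lemma poly_pderiv_prod_linear:
  fixes x :: real
  assumes "finite S" "x \<notin> S"
  shows "poly (pderiv (\<Prod>r\<in>S. [:-r, 1:])) x = (\<Prod>r\<in>S. x - r) * (\<Sum>r\<in>S. 1 / (x - r))"
  using assms
proof (induction S rule: finite_induct)
  case (insert a S)
  hence "x - a \<noteq> 0" by auto
  with insert show ?case
    by (simp add: pderiv_mult pderiv_pCons poly_prod field_simps del: mult_pCons_left)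
qed simp

text \<open>
For each root this is \<open>ln y \<le> y - 1\<close> at \<open>y = (t - r)/(e - r)\<close>.
\<close>

lemma ln_poly_le_tangent:
  fixes p :: "real poly"
  assumes p: "splits_over p S" "p \<noteq> 0" and same: "\<And>r. r \<in> S \<Longrightarrow> (t - r) * (e - r) > 0"
  shows "ln \<bar>poly p t\<bar> \<le> ln \<bar>poly p e\<bar> + (t - e) * (poly (pderiv p) e / poly p e)"
proof -
  define c where "c = lead_coeff p"
  have S: "finite S" and p_eq: "p = smult c (\<Prod>r\<in>S. [:-r, 1:])"
    using p by (auto simp: splits_over_def c_def)
  have c: "c \<noteq> 0" using p by (simp add: c_def)
  have nz: "t - r \<noteq> 0" "e - r \<noteq> 0" if "r \<in> S" for r using same[OF that] by auto
  have val: "poly p x = c * (\<Prod>r\<in>S. x - r)" for x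
    by (subst p_eq) (simp add: poly_prod)
  have ln_val: "ln \<bar>poly p x\<bar> = ln \<bar>c\<bar> + (\<Sum>r\<in>S. ln \<bar>x - r\<bar>)" if "\<And>r. r \<in> S \<Longrightarrow> x - r \<noteq> 0" for x
  proof -
    have "ln \<bar>poly p x\<bar> = ln (\<bar>c\<bar> * (\<Prod>r\<in>S. \<bar>x - r\<bar>))"
      by (simp add: val abs_mult abs_prod)
    also have "\<dots> = ln \<bar>c\<bar> + ln (\<Prod>r\<in>S. \<bar>x - r\<bar>)"
      using c that S by (intro ln_mult_pos prod_pos) auto
    also have "ln (\<Prod>r\<in>S. \<bar>x - r\<bar>) = (\<Sum>r\<in>S. ln \<bar>x - r\<bar>)"
      using that S by (intro ln_prod) auto
    finally show ?thesis .
  qed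
  have "e \<notin> S" using nz by force
  hence "poly (pderiv p) e = c * ((\<Prod>r\<in>S. e - r) * (\<Sum>r\<in>S. 1 / (e - r)))"
    by (subst p_eq) (simp only: pderiv_smult poly_smult poly_pderiv_prod_linear[OF S \<open>e \<notin> S\<close>])
  moreover have "(\<Prod>r\<in>S. e - r) \<noteq> 0" using nz S by simp
  ultimately have der: "poly (pderiv p) e / poly p e = (\<Sum>r\<in>S. 1 / (e - r))"
    using c by (simp add: val)
  have "ln \<bar>t - r\<bar> \<le> ln \<bar>e - r\<bar> + (t - e) * (1 / (e - r))" if r: "r \<in> S" for r
  proof -
    have q: "(t - r) / (e - r) > 0" using same[OF r] by (simp add: zero_less_divide_iff zero_less_mult_iff)
    have "ln \<bar>t - r\<bar> - ln \<bar>e - r\<bar> = ln \<bar>(t - r) / (e - r)\<bar>"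
      using nz[OF r] by (simp add: ln_div abs_divide)
    also have "\<dots> = ln ((t - r) / (e - r))" using q by (simp only: abs_of_pos)
    also have "\<dots> \<le> (t - r) / (e - r) - 1" using q by (rule ln_le_minus_one)
    also have "\<dots> = (t - e) * (1 / (e - r))" using nz[OF r] by (simp add: field_simps)
    finally show ?thesis by simp
  qed
  hence "(\<Sum>r\<in>S. ln \<bar>t - r\<bar>) \<le> (\<Sum>r\<in>S. ln \<bar>e - r\<bar> + (t - e) * (1 / (e - r)))"
    by (intro sum_mono)
  thus ?thesis using ln_val[of t] ln_val[of e] nz der
    by (simp add: sum.distrib sum_distrib_left)
qed

lemma increasing_imp_le:
  fixes \<tau> :: "nat \<Rightarrow> real"
  assumes "\<And>i. i < K \<Longrightarrow> \<tau> i < \<tau> (Suc i)" "i \<le> j" "j \<le> K"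
  shows "\<tau> i \<le> \<tau> j"
  using assms(2,3)
proof (induction j rule: dec_induct)
  case (step k)
  with assms(1)[of k] show ?case by simp
qed simp

lemma locate_interval:
  fixes \<tau> :: "nat \<Rightarrow> real"
  assumes "\<tau> 0 \<le> t" "t < \<tau> K"
  obtains i where "i < K" "\<tau> i \<le> t" "t < \<tau> (Suc i)"
  using assms(2)
proof (induction K arbitrary: thesis)
  case (Suc K)
  show ?case
  proof (cases "t < \<tau> K")
    case True
    with Suc.IH show ?thesis using Suc.prems(1) less_SucI by metis
  next
    case False
    with Suc.prems show ?thesis by (intro Suc.prems(1)[of K]) auto
  qed
qed (use assms in auto)

text \<open>
The degree condition says that every \<open>p j\<close> changes sign in as many intervals as its degree, so these sign
changes account for all its roots, and each interval contains at most one root of the \<open>p j\<close>.  A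
point \<open>t\<close> lies on one side of the root in its interval; the end point on that side is separated from \<open>t\<close> by
no root of any \<open>p j\<close>.
\<close>

lemma tangent_at_separating_point:
  fixes p :: "nat \<Rightarrow> real poly" and \<tau> :: "nat \<Rightarrow> real" and f :: "nat \<Rightarrow> nat"
  assumes mono: "\<And>i. i < K \<Longrightarrow> \<tau> i < \<tau> (Suc i)"
    and change: "\<And>i. i < K \<Longrightarrow> poly (p (f i)) (\<tau> i) * poly (p (f i)) (\<tau> (Suc i)) < 0"
    and deg: "\<And>j. j < J \<Longrightarrow> degree (p j) = card {i. i < K \<and> f i = j}"
    and nz: "\<And>j. j < J \<Longrightarrow> p j \<noteq> 0"
    and t: "\<tau> 0 \<le> t" "t < \<tau> K" "\<And>j. j < J \<Longrightarrow> poly (p j) t \<noteq> 0"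
  obtains i where "i \<le> K" "0 < i \<Longrightarrow> \<tau> (i - 1) \<le> t" "i < K \<Longrightarrow> t \<le> \<tau> (Suc i)"
    "\<And>j. j < J \<Longrightarrow> 0 < poly (p j) t * poly (p j) (\<tau> i)"
    "\<And>j. j < J \<Longrightarrow> ln \<bar>poly (p j) t\<bar> \<le> ln \<bar>poly (p j) (\<tau> i)\<bar> +
        (t - \<tau> i) * (poly (pderiv (p j)) (\<tau> i) / poly (p j) (\<tau> i))"
proof -
  have "\<exists>\<rho>. \<forall>i<K. \<tau> i < \<rho> i \<and> \<rho> i < \<tau> (Suc i) \<and> poly (p (f i)) (\<rho> i) = 0"
    using poly_IVT[OF mono change] by (intro choice) blast
  then obtain \<rho> where \<rho>: "\<And>i. i < K \<Longrightarrow> \<tau> i < \<rho> i" "\<And>i. i < K \<Longrightarrow> \<rho> i < \<tau> (Suc i)"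
    "\<And>i. i < K \<Longrightarrow> poly (p (f i)) (\<rho> i) = 0" by blast
  note le = increasing_imp_le[of K \<tau>, OF mono]
  have \<rho>_less: "\<rho> i < \<rho> k" if "i < k" "k < K" for i k
    using \<rho>(2)[of i] \<rho>(1)[of k] le[of "Suc i" k] that by force
  have inj: "inj_on \<rho> {..<K}"
    by (rule inj_onI) (metis \<rho>_less lessThan_iff less_irrefl linorder_neqE_nat)
  define S where "S j = \<rho> ` {i. i < K \<and> f i = j}" for j
  have split: "splits_over (p j) (S j)" if j: "j < J" for j
  proof (rule splits_overI)
    have "inj_on \<rho> {i. i < K \<and> f i = j}" by (rule inj_on_subset[OF inj]) auto
    thus "card (S j) = degree (p j)" by (simp add: S_def card_image deg[OF j])
  qed (use nz[OF j] \<rho>(3) in \<open>auto simp: S_def\<close>)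
  obtain k where k: "k < K" "\<tau> k \<le> t" "t < \<tau> (Suc k)"
    using locate_interval[OF t(1,2)] by metis
  \<comment> \<open>The end point of the interval on the same side of its root as \<open>t\<close>.\<close>
  define i where "i = (if t \<le> \<rho> k then k else Suc k)"
  have same: "(t - \<rho> l) * (\<tau> i - \<rho> l) > 0" if l: "l < K" "f l = j" "j < J" for l j
  proof -
    have "poly (p j) (\<rho> l) = 0" using \<rho>(3)[OF l(1)] l(2) by simp
    with t(3)[OF l(3)] have neq: "t \<noteq> \<rho> l" by auto
    consider "l < k" | "l > k" | "l = k" by linarith
    thus ?thesis
    proof cases
      case 1
      hence "\<rho> l < \<tau> k" using \<rho>(2)[OF l(1)] le[of "Suc l" k] k(1) by force
      thus ?thesis using k mono[of k] by (auto simp: i_def intro!: mult_pos_pos)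
    next
      case 2
      hence "\<tau> (Suc k) < \<rho> l" using \<rho>(1)[OF l(1)] le[of "Suc k" l] l(1) by force
      thus ?thesis using k mono[of k] by (auto simp: i_def intro!: mult_neg_neg)
    next
      case 3
      thus ?thesis using neq \<rho>(1,2)[OF k(1)]
        by (auto simp: i_def intro: mult_neg_neg mult_pos_pos)
    qed
  qed
  show ?thesis
  proof (rule that)
    show "i \<le> K" "0 < i \<Longrightarrow> \<tau> (i - 1) \<le> t" "i < K \<Longrightarrow> t \<le> \<tau> (Suc i)"
      using k mono[of "Suc k"] le[of "k - 1" k] by (auto simp: i_def)
    fix j assume j: "j < J"
    have same': "(t - r) * (\<tau> i - r) > 0" if "r \<in> S j" for r
      using that same j by (auto simp: S_def)
    show "ln \<bar>poly (p j) t\<bar> \<le> ln \<bar>poly (p j) (\<tau> i)\<bar> +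
        (t - \<tau> i) * (poly (pderiv (p j)) (\<tau> i) / poly (p j) (\<tau> i))"
      using ln_poly_le_tangent[OF split[OF j] nz[OF j] same'] .
    have val: "poly (p j) x = lead_coeff (p j) * (\<Prod>r\<in>S j. x - r)" for x
      using split[OF j] by (metis (no_types, lifting) splits_over_def poly_smult poly_prod
          prod.cong poly_pCons poly_1 mult.right_neutral add.commute mult.commute uminus_add_conv_diff pCons_one)
    have "poly (p j) t * poly (p j) (\<tau> i) = lead_coeff (p j) ^ 2 * (\<Prod>r\<in>S j. (t - r) * (\<tau> i - r))"
      by (simp add: val[of t] val[of "\<tau> i"] prod.distrib power2_eq_square)
    also have "\<dots> > 0"
    proof (rule mult_pos_pos)
      show "0 < (\<Prod>r\<in>S j. (t - r) * (\<tau> i - r))" by (rule prod_pos) (use same' in blast)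
    qed (use nz[OF j] in simp)
    finally show "0 < poly (p j) t * poly (p j) (\<tau> i)" .
  qed
qed

section \<open>Integer arithmetic that bounds weighted sums of logarithms\<close>

text \<open>
A point \<open>n/d\<close> is treated through the integers \<open>d\<^sup>k p(n/d)\<close>.  Logarithms are split into a multiple of
\<open>ln 2\<close> and the logarithm of a number between 1 and 2; the latter is rounded upwards in fixed-point arithmetic with
unit \<open>1/2\<^sup>2\<^sup>0\<close> (the constant 1048576).  Intermediate results of the logarithm bounds are passed as
arguments to auxiliary functions, so that rewriting evaluates them only once.
\<close>

text \<open>
The series of \<open>2 artanh z\<close>, with its tail bounded by a geometric series of quotient \<open>z\<^sup>2 \<le> 1/9\<close>; the factor
\<open>9/8 = 1/(1 - 1/9)\<close> turns \<open>1/7\<close> into \<open>9/56\<close>.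
\<close>

lemma ln_ratio_le:
  fixes z :: real
  assumes "0 \<le> z" "z \<le> 1/3"
  shows "ln ((1 + z) / (1 - z)) \<le> 2 * (z + z^3 / 3 + z^5 / 5 + 9 * z^7 / 56)"
proof (cases "z = 0")
  case False
  define x where "x = (1 + z) / (1 - z)"
  have "x > 1" "(x - 1) / (x + 1) = z" using assms False by (simp_all add: x_def field_simps)
  hence "ln x \<le> (\<Sum>k<3. 2 * z ^ (2 * k + 1) / real (2 * k + 1)) + 2 * (z ^ 7 / (1 - z^2) / 7)"
    using ln_approx_bounds[of x 3] by simp
  also have "(\<Sum>k<3. 2 * z ^ (2 * k + 1) / real (2 * k + 1)) = 2 * (z + z^3 / 3 + z^5 / 5)"
    by (simp add: eval_nat_numeral)
  also have "z ^ 7 / (1 - z^2) \<le> z ^ 7 / (8 / 9)"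
  proof (intro divide_left_mono mult_pos_pos)
    have "z^2 \<le> (1/3)^2" using assms by (intro power_mono) auto
    thus "8 / 9 \<le> 1 - z^2" "0 < 1 - z^2" by (simp_all add: power2_eq_square)
  qed (use assms in auto)
  finally show ?thesis by (simp add: x_def)
qed simp

lemma div_real_bounds:
  fixes a b :: int
  shows "real_of_int (a div b) \<le> of_int a / of_int b" "of_int a / of_int b < real_of_int (a div b) + 1"
  by (metis floor_divide_of_int_eq of_int_floor_le) (metis floor_divide_of_int_eq real_of_int_floor_add_one_gt)

text \<open>
Coefficients are listed from the constant term upwards.  For a list of length \<open>k+1\<close> the three results are
\<open>d\<^sup>k p(n/d)\<close>, \<open>d\<^bsup>k-1\<^esup> p'(n/d)\<close> and \<open>d\<^bsup>k+1\<^esup>\<close>.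
\<close>

fun hom_eval :: "int \<Rightarrow> int \<Rightarrow> int list \<Rightarrow> int \<times> int \<times> int" where
  "hom_eval n d [] = (0, 0, 1)"
| "hom_eval n d (a # as) = (case hom_eval n d as of (h, v, P) \<Rightarrow> (a * P + n * h, h + n * v, d * P))"

abbreviation rpoly :: "int list \<Rightarrow> real poly" where "rpoly q \<equiv> map_poly of_int (Poly q)"

text \<open>
Multiplied by \<open>d\<close> and \<open>d\<^sup>2\<close>, so that the exponents are natural numbers for every length of the list.
\<close>

lemma hom_eval:
  assumes "d > 0" "hom_eval n d q = (h, v, P)" and x: "x = of_int n / of_int d"
  shows "P = d ^ length q \<and> of_int h * of_int d = of_int d ^ length q * poly (rpoly q) x \<and>
         of_int v * of_int d ^ 2 = of_int d ^ length q * poly (pderiv (rpoly q)) x"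
  using assms(2)
proof (induction q arbitrary: h v P)
  case (Cons a q)
  obtain h' v' P' where e: "hom_eval n d q = (h', v', P')" by (metis prod_cases3)
  have eq: "h = a * P' + n * h'" "v = h' + n * v'" "P = d * P'" using Cons.prems e by auto
  note IH = Cons.IH[OF e]
  have n: "of_int n = x * of_int d" using x assms(1) by simp
  have pc: "rpoly (a # q) = pCons (of_int a) (rpoly q)" by (simp add: of_int_hom.map_poly_pCons_hom)
  have "of_int h * of_int d = of_int d * (of_int a * of_int P' + x * (of_int h' * of_int d :: real))"
    by (simp add: eq n algebra_simps)
  also have "\<dots> = of_int d ^ length (a # q) * poly (rpoly (a # q)) x"
    using IH unfolding pc by (simp add: algebra_simps)
  finally have 1: "of_int h * of_int d = of_int d ^ length (a # q) * poly (rpoly (a # q)) x" .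
  have "of_int v * of_int d ^ 2 = of_int d * ((of_int h' * of_int d) + x * (of_int v' * of_int d ^ 2 :: real))"
    by (simp add: eq n algebra_simps power2_eq_square)
  also have "\<dots> = of_int d ^ length (a # q) * poly (pderiv (rpoly (a # q))) x"
    using IH unfolding pc by (simp add: algebra_simps pderiv_pCons)
  finally show ?case using 1 IH by (simp add: eq)
qed auto

text \<open>
One Horner step in \<open>z\<^sup>2\<close> with upward rounding.  The constants below are \<open>1/3\<close> and \<open>1/5\<close> in units of
\<open>1/2\<^sup>2\<^sup>0\<close>, rounded up.
\<close>

definition artanh_step :: "int \<Rightarrow> int \<Rightarrow> int \<Rightarrow> int" where
  "artanh_step c z2 h = z2 * (c + h) div 1048576 + 1"

definition artanh_poly :: "int \<Rightarrow> int \<Rightarrow> int" where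
  "artanh_poly z z2 =
     2 * (z * (1048576 + artanh_step 349526 z2 (artanh_step 209716 z2 (9 * z2 div 56 + 1))) div 1048576 + 1)"

definition artanh_bound :: "int \<Rightarrow> int" where
  "artanh_bound z = artanh_poly z (z * z div 1048576 + 1)"

definition ln_ratio_bound :: "int \<Rightarrow> int \<Rightarrow> int" where
  "ln_ratio_bound u p = artanh_bound ((u - p) * 1048576 div (u + p) + 1)"

lemma artanh_step:
  fixes y g a :: real
  assumes "0 \<le> y" "y \<le> of_int z2 / 1048576" "0 \<le> g" "g \<le> of_int h / 1048576" "0 \<le> a" "a \<le> of_int c / 1048576"
  shows "y * (a + g) \<le> of_int (artanh_step c z2 h) / 1048576"
proof -
  have "y * (a + g) \<le> of_int z2 / 1048576 * (of_int (c + h) / 1048576)"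
    using assms by (intro mult_mono) auto
  also have "\<dots> = (of_int (z2 * (c + h)) / of_int 1048576) / 1048576" by simp
  also have "\<dots> \<le> of_int (artanh_step c z2 h) / 1048576"
    unfolding artanh_step_def using div_real_bounds(2)[of "z2 * (c + h)" 1048576]
    by (intro divide_right_mono) auto
  finally show ?thesis .
qed

lemma artanh_bound:
  fixes x :: real
  assumes "0 \<le> x" "x \<le> 1/3" "x \<le> of_int z / 1048576"
  shows "ln ((1 + x) / (1 - x)) \<le> of_int (artanh_bound z) / 1048576"
proof -
  define z2 where "z2 = z * z div 1048576 + 1"
  have y: "x^2 \<le> of_int z2 / 1048576"
  proof -
    have "x^2 \<le> (of_int z / 1048576)^2" using assms by (intro power_mono) auto
    also have "\<dots> = (of_int (z * z) / of_int 1048576) / 1048576" by (simp add: power2_eq_square)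
    also have "\<dots> \<le> of_int z2 / 1048576"
      unfolding z2_def using div_real_bounds(2)[of "z * z" 1048576] by (intro divide_right_mono) auto
    finally show ?thesis .
  qed
  have h1: "9 / 56 * x^2 \<le> of_int (9 * z2 div 56 + 1) / 1048576"
    using y div_real_bounds(2)[of "9 * z2" 56] by simp
  have h2: "x^2 * (1/5 + 9 / 56 * x^2) \<le> of_int (artanh_step 209716 z2 (9 * z2 div 56 + 1)) / 1048576"
    by (rule artanh_step) (use y h1 in auto)
  have h3: "x^2 * (1/3 + x^2 * (1/5 + 9 / 56 * x^2)) \<le>
      of_int (artanh_step 349526 z2 (artanh_step 209716 z2 (9 * z2 div 56 + 1))) / 1048576"
    by (rule artanh_step) (use y h2 in auto)
  define w where "w = 1048576 + artanh_step 349526 z2 (artanh_step 209716 z2 (9 * z2 div 56 + 1))"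
  have "x * (1 + x^2 * (1/3 + x^2 * (1/5 + 9 / 56 * x^2))) \<le> of_int z / 1048576 * (of_int w / 1048576)"
    using assms h3 by (intro mult_mono) (auto simp: w_def)
  also have "\<dots> = (of_int (z * w) / of_int 1048576) / 1048576" by simp
  also have "\<dots> \<le> of_int (z * w div 1048576 + 1) / 1048576"
    using div_real_bounds(2)[of "z * w" 1048576] by (intro divide_right_mono) auto
  finally have "2 * (x * (1 + x^2 * (1/3 + x^2 * (1/5 + 9 / 56 * x^2)))) \<le> of_int (artanh_bound z) / 1048576"
    by (simp add: artanh_bound_def artanh_poly_def z2_def w_def)
  moreover have "2 * (x * (1 + x^2 * (1/3 + x^2 * (1/5 + 9 / 56 * x^2)))) = 2 * (x + x^3 / 3 + x^5 / 5 + 9 * x^7 / 56)"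
    by (simp add: algebra_simps eval_nat_numeral)
  ultimately show ?thesis using ln_ratio_le[OF assms(1,2)] by linarith
qed

text \<open>
With \<open>x = (u-p)/(u+p)\<close> the ratio \<open>u/p\<close> is \<open>(1+x)/(1-x)\<close>, and \<open>u \<le> 2p\<close> means \<open>x \<le> 1/3\<close>.
\<close>

lemma ln_ratio_bound:
  assumes "0 < p" "p \<le> u" "u \<le> 2 * p"
  shows "ln (real_of_int u) \<le> ln (real_of_int p) + of_int (ln_ratio_bound u p) / 1048576"
proof -
  define x where "x = (of_int u - of_int p) / (of_int u + of_int p :: real)"
  have r: "real_of_int p > 0" "real_of_int p \<le> of_int u" "real_of_int u \<le> 2 * of_int p" using assms by linarith+
  have "0 \<le> x" "x \<le> 1/3" using r by (auto simp: x_def field_simps)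
  moreover have "x \<le> of_int ((u - p) * 1048576 div (u + p) + 1) / 1048576"
    using div_real_bounds(2)[of "(u - p) * 1048576" "u + p"] r by (simp add: x_def field_simps)
  ultimately have "ln ((1 + x) / (1 - x)) \<le> of_int (ln_ratio_bound u p) / 1048576"
    unfolding ln_ratio_bound_def by (rule artanh_bound)
  moreover have "(1 + x) / (1 - x) = of_int u / of_int p"
  proof -
    have "1 + x = 2 * of_int u / (of_int u + of_int p)" "1 - x = 2 * of_int p / (of_int u + of_int p)"
      using r by (simp_all add: x_def field_simps)
    thus ?thesis using r by simp
  qed
  ultimately show ?thesis using r by (simp add: ln_div)
qed

fun double_pow2 :: "int \<times> int \<Rightarrow> int \<times> int" where
  "double_pow2 (p, e) = (2 * p, e + 1)"

text \<open>
For positive \<open>u\<close> the result consists of the power of two and its exponent.  Halving follows the binary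
representation of numerals, so that each bit costs one rewrite step.
\<close>

function log2_floor :: "int \<Rightarrow> int \<times> int" where
  "log2_floor u = (if u \<le> 1 then (1, 0) else double_pow2 (log2_floor (u div 2)))"
  by auto
termination by (relation "measure nat") auto
declare log2_floor.simps [simp del]

lemma log2_floor_numeral:
  "log2_floor 0 = (1, 0)" "log2_floor 1 = (1, 0)"
  "log2_floor (numeral (num.Bit0 k)) = double_pow2 (log2_floor (numeral k))"
  "log2_floor (numeral (num.Bit1 k)) = double_pow2 (log2_floor (numeral k))"
  by (subst log2_floor.simps; simp)+

lemma log2_floor:
  assumes "1 \<le> u" "log2_floor u = (p, e)"
  shows "0 < p" "p \<le> u" "u \<le> 2 * p" "ln (real_of_int p) = of_int e * ln 2"
proof -
  have "0 < p \<and> p \<le> u \<and> u < 2 * p \<and> ln (real_of_int p) = of_int e * ln 2"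
    using assms
  proof (induction u arbitrary: p e rule: log2_floor.induct)
    case (1 u)
    show ?case
    proof (cases "u \<le> 1")
      case False
      obtain p' e' where e: "log2_floor (u div 2) = (p', e')" by force
      from 1(1)[OF False _ e] False
      have IH: "0 < p'" "p' \<le> u div 2" "u div 2 < 2 * p'" "ln (real_of_int p') = of_int e' * ln 2"
        by auto
      have "p = 2 * p'" "e = e' + 1" using 1(3) False e by (simp_all add: log2_floor.simps[of u])
      thus ?thesis using IH by (auto simp: ln_mult algebra_simps)
    qed (use 1 in \<open>auto simp: log2_floor_numeral\<close>)
  qed
  thus "0 < p" "p \<le> u" "u \<le> 2 * p" "ln (real_of_int p) = of_int e * ln 2" by simp_all
qed

text \<open>
Division truncated towards zero; it reduces division of signed numerals to that of positive ones.
\<close>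

definition trunc_quot :: "int \<Rightarrow> int \<Rightarrow> int" where
  "trunc_quot a b = sgn a * sgn b * (\<bar>a\<bar> div \<bar>b\<bar>)"

lemma trunc_quot: "\<bar>of_int a / of_int b - of_int (trunc_quot a b)\<bar> \<le> (1::real)"
proof -
  have "\<bar>of_int \<bar>a\<bar> / of_int \<bar>b\<bar> - of_int (\<bar>a\<bar> div \<bar>b\<bar>)\<bar> \<le> (1::real)"
    using div_real_bounds[of "\<bar>a\<bar>" "\<bar>b\<bar>"] by linarith
  moreover have "of_int a / of_int b - of_int (trunc_quot a b) =
      of_int (sgn a * sgn b) * (of_int \<bar>a\<bar> / of_int \<bar>b\<bar> - of_int (\<bar>a\<bar> div \<bar>b\<bar>) :: real)"
    by (auto simp: trunc_quot_def sgn_if abs_if)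
  moreover have "\<bar>of_int (sgn a * sgn b) :: real\<bar> \<le> 1" by (auto simp: sgn_if)
  ultimately show ?thesis by (metis abs_mult abs_ge_zero mult_le_one)
qed

fun add_log :: "int \<Rightarrow> int \<Rightarrow> int \<times> int \<Rightarrow> int \<times> int \<times> int \<Rightarrow> int \<times> int \<times> int" where
  "add_log k u (p, e) (L, E, s) = (L + k * ln_ratio_bound u p, E + k * e, s)"

fun add_term :: "int \<Rightarrow> int \<times> int \<times> int \<Rightarrow> int \<times> int \<times> int \<Rightarrow> int \<times> int \<times> int" where
  "add_term k (h, v, P) (L, E, s) = add_log k \<bar>h\<bar> (log2_floor \<bar>h\<bar>) (L, E, s + trunc_quot (k * 100 * v) h)"

text \<open>
For weighted polynomials \<open>(k, q)\<close> the three totals are the sum of the \<open>k\<close>-fold fixed-point parts of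
\<open>ln \<bar>d\<^sup>m q(n/d)\<bar>\<close>, with \<open>m\<close> the degree of \<open>q\<close>, the sum of their multiples of \<open>ln 2\<close>, and an
approximation of the sum of the \<open>100 k q'(x)/(d q(x))\<close>.  The scale 100 keeps the rounding errors of the slope small.
\<close>

fun totals :: "int \<Rightarrow> int \<Rightarrow> (int \<times> int list) list \<Rightarrow> int \<times> int \<times> int" where
  "totals n d [] = (0, 0, 0)"
| "totals n d ((k, q) # qs) = add_term k (hom_eval n d q) (totals n d qs)"

lemma totals:
  assumes d: "d > 0" and x: "x = of_int n / of_int d"
    and "\<And>k q. (k, q) \<in> set qs \<Longrightarrow> k \<ge> 0 \<and> q \<noteq> [] \<and> poly (rpoly q) x \<noteq> 0"
    and "totals n d qs = (L, E, s)"
  shows "(\<Sum>(k, q)\<leftarrow>qs. of_int k * ln \<bar>poly (rpoly q) x\<bar>) \<le>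
           of_int L / 1048576 + of_int E * ln 2 - (\<Sum>(k, q)\<leftarrow>qs. of_int k * real (length q - 1)) * ln (of_int d) \<and>
         \<bar>100 * (\<Sum>(k, q)\<leftarrow>qs. of_int k * (poly (pderiv (rpoly q)) x / poly (rpoly q) x)) - of_int d * of_int s\<bar>
           \<le> of_int d * real (length qs)"
  using assms(3,4)
proof (induction qs arbitrary: L E s)
  case (Cons kq qs)
  obtain k q where kq: "kq = (k, q)" by force
  have k: "k \<ge> 0" "q \<noteq> []" "poly (rpoly q) x \<noteq> 0" using Cons.prems(1)[of k q] by (auto simp: kq)
  obtain L' E' s' where t: "totals n d qs = (L', E', s')" by (metis prod_cases3)
  obtain h v P where hv: "hom_eval n d q = (h, v, P)" by (metis prod_cases3)
  obtain p e where pe: "log2_floor \<bar>h\<bar> = (p, e)" by force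
  have eqs: "L = L' + k * ln_ratio_bound \<bar>h\<bar> p" "E = E' + k * e" "s = s' + trunc_quot (k * 100 * v) h"
    using Cons.prems(2) by (auto simp: kq t hv pe)
  have IH: "(\<Sum>(k, q)\<leftarrow>qs. of_int k * ln \<bar>poly (rpoly q) x\<bar>) \<le>
           of_int L' / 1048576 + of_int E' * ln 2 - (\<Sum>(k, q)\<leftarrow>qs. of_int k * real (length q - 1)) * ln (of_int d)"
    "\<bar>100 * (\<Sum>(k, q)\<leftarrow>qs. of_int k * (poly (pderiv (rpoly q)) x / poly (rpoly q) x)) - of_int d * of_int s'\<bar>
           \<le> of_int d * real (length qs)"
    using Cons.IH[OF _ t] Cons.prems(1) by auto
  note ev = hom_eval[OF d hv x]
  define l where "l = length q - 1"
  have len: "length q = Suc l" using k(2) by (simp add: l_def)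
  have dr: "real_of_int d > 0" using d by simp
  have h_eq: "of_int h = of_int d ^ l * poly (rpoly q) x"
    using ev dr by (simp add: len)
  have v_eq: "of_int v * of_int d = of_int d ^ l * poly (pderiv (rpoly q)) x"
    using ev dr by (simp add: len power2_eq_square)
  have h0: "h \<noteq> 0" using h_eq k(3) dr by auto
  have pe': "0 < p" "p \<le> \<bar>h\<bar>" "\<bar>h\<bar> \<le> 2 * p" "ln (real_of_int p) = of_int e * ln 2"
    using log2_floor[OF _ pe] h0 by auto
  have "ln \<bar>poly (rpoly q) x\<bar> = ln (of_int \<bar>h\<bar>) - real l * ln (of_int d)"
    using k(3) dr by (simp add: h_eq abs_mult ln_mult ln_realpow)
  also have "\<dots> \<le> of_int e * ln 2 + of_int (ln_ratio_bound \<bar>h\<bar> p) / 1048576 - real l * ln (of_int d)"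
    using ln_ratio_bound[OF pe'(1-3)] pe'(4) by simp
  finally have "of_int k * ln \<bar>poly (rpoly q) x\<bar> \<le>
      of_int k * (of_int e * ln 2 + of_int (ln_ratio_bound \<bar>h\<bar> p) / 1048576 - real l * ln (of_int d))"
    using k(1) by (intro mult_left_mono) auto
  hence 1: "of_int k * ln \<bar>poly (rpoly q) x\<bar> \<le> of_int (k * ln_ratio_bound \<bar>h\<bar> p) / 1048576 + of_int (k * e) * ln 2
     - of_int k * real l * ln (of_int d)" by (simp add: algebra_simps)
  have "poly (pderiv (rpoly q)) x / poly (rpoly q) x = of_int d * (of_int v / of_int h)"
    using v_eq k(3) dr by (simp add: h_eq field_simps)
  hence "100 * (of_int k * (poly (pderiv (rpoly q)) x / poly (rpoly q) x)) = of_int d * (of_int (k * 100 * v) / of_int h)"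
    by simp
  moreover have "\<bar>of_int (k * 100 * v) / of_int h - of_int (trunc_quot (k * 100 * v) h)\<bar> \<le> (1 :: real)"
    by (rule trunc_quot)
  hence "\<bar>of_int d * (of_int (k * 100 * v) / of_int h) - of_int d * of_int (trunc_quot (k * 100 * v) h)\<bar> \<le> real_of_int d * 1"
    using dr by (simp only: right_diff_distrib[symmetric] abs_mult) (intro mult_mono, auto)
  ultimately have 2: "\<bar>100 * (of_int k * (poly (pderiv (rpoly q)) x / poly (rpoly q) x)) - of_int d * of_int (trunc_quot (k * 100 * v) h)\<bar> \<le> real_of_int d"
    by simp
  have "(\<Sum>(k, q)\<leftarrow>kq # qs. of_int k * ln \<bar>poly (rpoly q) x\<bar>) \<le>
           of_int L / 1048576 + of_int E * ln 2 - (\<Sum>(k, q)\<leftarrow>kq # qs. of_int k * real (length q - 1)) * ln (of_int d)"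
    using 1 IH(1) by (simp add: kq eqs l_def add_divide_distrib algebra_simps)
  moreover have "\<bar>100 * (\<Sum>(k, q)\<leftarrow>kq # qs. of_int k * (poly (pderiv (rpoly q)) x / poly (rpoly q) x)) - of_int d * of_int s\<bar>
           \<le> of_int d * real (length (kq # qs))"
    using 2 IH(2) by (simp add: kq eqs distrib_left)
  ultimately show ?case by blast
qed simp

lemma ln_2_bounds: "6931471 / 10000000 \<le> ln (2::real)" "ln (2::real) \<le> 6931472 / 10000000"
  using ln_approx_bounds[of 2 8] by (simp_all add: eval_nat_numeral)

fun add_denominator :: "int \<Rightarrow> int \<Rightarrow> int \<times> int \<Rightarrow> int \<times> int \<times> int \<Rightarrow> int \<times> int \<times> int" where
  "add_denominator N d (p, e) (L, E, s) = (L + N * ln_ratio_bound (2 * p) d, E - N * (e + 1), s)"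

text \<open>
The slope enters through \<open>g\<close>, a bound for \<open>1000 d \<bar>t - x\<bar>\<close>.  All terms are brought to the unit \<open>10\<^sup>-\<^sup>7\<close>
and multiplied by \<open>2\<^sup>2\<^sup>0\<close>; a negative multiple of \<open>ln 2\<close> is estimated with the lower bound for \<open>ln 2\<close>.
\<close>

fun total_le :: "int \<Rightarrow> int \<Rightarrow> int \<times> int \<times> int \<Rightarrow> bool" where
  "total_le b g (L, E, s) \<longleftrightarrow> L * 10000000 + (E * (if 0 \<le> E then 6931472 else 6931471) + g * \<bar>s\<bar> * 100) * 1048576 \<le> b * 1048576"

text \<open>
The value of the tangent at \<open>n/d\<close> is tested up to the two neighbouring points, as a point between two neighbours
may use the tangent at either of them.  The target \<open>-1.721178\<close> per unit of weighted degree slightly exceeds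
\<open>4 ln 1.53770952\<close> in absolute value; the term with the number of polynomials covers the rounding of the slope.
\<close>

fun check_point :: "int \<Rightarrow> (int \<times> int list) list \<Rightarrow> int \<times> int \<Rightarrow> int \<times> int \<Rightarrow> int \<times> int \<Rightarrow> bool" where
  "check_point N qs (n0, d0) (n, d) (n1, d1) \<longleftrightarrow>
     total_le (- 17211780 * N - 100 * int (length qs) * (max (1000 * (n1 * d - n * d1) div d1) (1000 * (n * d0 - n0 * d) div d0) + 1))
       (max (1000 * (n1 * d - n * d1) div d1) (1000 * (n * d0 - n0 * d) div d0) + 1)
       (add_denominator N d (log2_floor d) (totals n d qs))"

abbreviation frac_of :: "int \<times> int \<Rightarrow> real" where "frac_of a \<equiv> of_int (fst a) / of_int (snd a)"

definition total_degree :: "(int \<times> int list) list \<Rightarrow> int" where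
  "total_degree qs = (\<Sum>(k, q)\<leftarrow>qs. k * int (length q - 1))"

lemma of_int_total_degree:
  "of_int (total_degree qs) = (\<Sum>(k, q)\<leftarrow>qs. of_int k * real (length q - 1))"
  unfolding total_degree_def by (induction qs) auto

lemma check_point:
  assumes chk: "check_point (total_degree qs) qs (n0, d0) (n, d) (n1, d1)"
    and d: "0 < d0" "0 < d" "0 < d1"
    and t: "frac_of (n0, d0) \<le> t" "t \<le> frac_of (n1, d1)"
    and mid: "frac_of (n0, d0) \<le> frac_of (n, d)" "frac_of (n, d) \<le> frac_of (n1, d1)"
    and x: "x = frac_of (n, d)"
    and qs: "\<And>k q. (k, q) \<in> set qs \<Longrightarrow> k \<ge> 0 \<and> q \<noteq> [] \<and> poly (rpoly q) x \<noteq> 0"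
  shows "(\<Sum>(k, q)\<leftarrow>qs. of_int k * (ln \<bar>poly (rpoly q) x\<bar> + (t - x) * (poly (pderiv (rpoly q)) x / poly (rpoly q) x)))
           \<le> - 1.721178 * of_int (total_degree qs)"
proof -
  define N where "N = total_degree qs"
  define J where "J = int (length qs)"
  define g where "g = max (1000 * (n1 * d - n * d1) div d1) (1000 * (n * d0 - n0 * d) div d0) + 1"
  obtain L E s where tot: "totals n d qs = (L, E, s)" by (metis prod_cases3)
  obtain p e where pe: "log2_floor d = (p, e)" by force
  define A where "A = (\<Sum>(k, q)\<leftarrow>qs. of_int k * ln \<bar>poly (rpoly q) x\<bar>)"
  define B where "B = (\<Sum>(k, q)\<leftarrow>qs. of_int k * (poly (pderiv (rpoly q)) x / poly (rpoly q) x))"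
  have N_eq: "(\<Sum>(k, q)\<leftarrow>qs. of_int k * real (length q - 1)) = of_int N"
    unfolding N_def by (rule of_int_total_degree[symmetric])
  have N0: "N \<ge> 0"
    unfolding N_def total_degree_def using qs by (intro sum_list_nonneg) auto
  have x': "x = of_int n / of_int d" using x by simp
  have A: "A \<le> of_int L / 1048576 + of_int E * ln 2 - of_int N * ln (of_int d)"
    and B: "\<bar>100 * B - of_int d * of_int s\<bar> \<le> of_int d * of_int J"
    using totals[OF d(2) x' qs tot] unfolding A_def[symmetric] B_def[symmetric] N_eq
    by (simp_all add: J_def)
  have dr: "real_of_int d > 0" "real_of_int d0 > 0" "real_of_int d1 > 0" using d by simp_all
  have p: "0 < p" "p \<le> d" "d \<le> 2 * p" "ln (real_of_int p) = of_int e * ln 2"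
    using log2_floor[OF _ pe] d(2) by auto
  \<comment> \<open>A lower bound for ln d comes from an upper bound for the logarithm of 2p/d.\<close>
  define R where "R = ln_ratio_bound (2 * p) d"
  have "ln (real_of_int (2 * p)) \<le> ln (real_of_int d) + of_int R / 1048576"
    unfolding R_def using p d(2) by (intro ln_ratio_bound) auto
  moreover have "ln (real_of_int (2 * p)) = of_int (e + 1) * ln 2"
    using p(1,4) by (simp add: ln_mult algebra_simps)
  ultimately have "- ln (real_of_int d) \<le> of_int R / 1048576 - of_int (e + 1) * ln 2" by simp
  hence "of_int N * - ln (real_of_int d) \<le> of_int N * (of_int R / 1048576 - of_int (e + 1) * ln 2)"
    using N0 by (intro mult_left_mono) auto
  define L' where "L' = L + N * R"
  define E' where "E' = E - N * (e + 1)"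
  have "A \<le> of_int L' / 1048576 + of_int E' * ln 2"
    using A \<open>of_int N * - ln (real_of_int d) \<le> _\<close>
    by (simp add: L'_def E'_def algebra_simps add_divide_distrib)
  also have "of_int E' * ln 2 \<le> of_int (E' * (if 0 \<le> E' then 6931472 else 6931471)) / (10000000::real)"
  proof (cases "0 \<le> E'")
    case True
    hence "of_int E' * ln 2 \<le> of_int E' * (6931472 / 10000000 :: real)"
      using ln_2_bounds by (intro mult_left_mono) auto
    thus ?thesis using True by simp
  next
    case False
    hence "of_int E' * ln 2 \<le> of_int E' * (6931471 / 10000000 :: real)"
      using ln_2_bounds by (intro mult_left_mono_neg) auto
    thus ?thesis using False by simp
  qed
  finally have A': "A \<le> of_int L' / 1048576 + of_int (E' * (if 0 \<le> E' then 6931472 else 6931471)) / 10000000"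
    by simp
  have gap: "\<bar>t - x\<bar> * of_int d \<le> of_int g / 1000"
  proof -
    have "(t - x) * of_int d \<le> (of_int n1 / of_int d1 - of_int n / of_int d) * of_int d"
      using t(2) x dr by (intro mult_right_mono) auto
    also have "\<dots> = of_int (1000 * (n1 * d - n * d1)) / of_int d1 / 1000"
      using dr by (simp add: field_simps)
    also have "\<dots> \<le> of_int g / 1000"
      using div_real_bounds(2)[of "1000 * (n1 * d - n * d1)" d1] unfolding g_def
      by (intro divide_right_mono) linarith+
    finally have 1: "(t - x) * of_int d \<le> of_int g / 1000" .
    have "(x - t) * of_int d \<le> (of_int n / of_int d - of_int n0 / of_int d0) * of_int d"
      using t(1) x dr by (intro mult_right_mono) auto
    also have "\<dots> = of_int (1000 * (n * d0 - n0 * d)) / of_int d0 / 1000"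
      using dr by (simp add: field_simps)
    also have "\<dots> \<le> of_int g / 1000"
      using div_real_bounds(2)[of "1000 * (n * d0 - n0 * d)" d0] unfolding g_def
      by (intro divide_right_mono) linarith+
    finally have 2: "(x - t) * of_int d \<le> of_int g / 1000" .
    show ?thesis using 1 2 by (cases "t \<ge> x") (simp_all add: abs_if)
  qed
  have "(t - x) * B \<le> \<bar>t - x\<bar> * \<bar>B\<bar>" by (metis abs_ge_self abs_mult)
  also have "\<bar>B\<bar> \<le> of_int d * of_int (\<bar>s\<bar> + J) / 100"
  proof -
    have "\<bar>100 * B\<bar> \<le> of_int d * of_int J + \<bar>of_int d * of_int s\<bar>" using B by linarith
    thus ?thesis using dr by (simp add: abs_mult distrib_left)
  qed
  also have "\<bar>t - x\<bar> * (of_int d * of_int (\<bar>s\<bar> + J) / 100) = \<bar>t - x\<bar> * of_int d * (of_int (\<bar>s\<bar> + J) / 100)"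
    by simp
  also have "\<dots> \<le> of_int g / 1000 * (of_int (\<bar>s\<bar> + J) / 100)"
    using gap by (intro mult_right_mono) (auto simp: J_def)
  finally have slope: "(t - x) * B \<le> of_int (g * (\<bar>s\<bar> + J) * 100) / 10000000"
    by (simp add: mult_left_mono)
  have "L' * 10000000 + (E' * (if 0 \<le> E' then 6931472 else 6931471) + g * \<bar>s\<bar> * 100) * 1048576
      \<le> (- 17211780 * N - 100 * J * g) * 1048576"
    using chk
    unfolding check_point.simps g_def[symmetric] J_def[symmetric] N_def[symmetric] tot pe
      add_denominator.simps total_le.simps R_def[symmetric] L'_def[symmetric] E'_def[symmetric] .
  hence "L' * 10000000 + (E' * (if 0 \<le> E' then 6931472 else 6931471) + g * (\<bar>s\<bar> + J) * 100) * 1048576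
      \<le> - 17211780 * N * 1048576"
    by (simp add: algebra_simps)
  hence "real_of_int (L' * 10000000 + (E' * (if 0 \<le> E' then 6931472 else 6931471) + g * (\<bar>s\<bar> + J) * 100) * 1048576)
      \<le> of_int (- 17211780 * N * 1048576)"
    unfolding of_int_le_iff .
  hence "of_int L' / 1048576 + of_int (E' * (if 0 \<le> E' then 6931472 else 6931471)) / 10000000
      + of_int (g * (\<bar>s\<bar> + J) * 100) / 10000000 \<le> - 1.721178 * (of_int N :: real)"
    by (simp add: field_simps del: if_split)
  hence "A + (t - x) * B \<le> - 1.721178 * of_int N"
    using A' slope by linarith
  moreover have "(\<Sum>(k, q)\<leftarrow>qs. of_int k * (ln \<bar>poly (rpoly q) x\<bar> + (t - x) * (poly (pderiv (rpoly q)) x / poly (rpoly q) x))) = A + (t - x) * B"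
  proof -
    have "(\<Sum>(k, q)\<leftarrow>qs. of_int k * (l q + c * r q)) =
        (\<Sum>(k, q)\<leftarrow>qs. of_int k * l q) + c * (\<Sum>(k, q)\<leftarrow>qs. of_int k * r q)"
      for l r :: "int list \<Rightarrow> real" and c
      by (induction qs) (auto simp: algebra_simps)
    thus ?thesis unfolding A_def B_def .
  qed
  ultimately show ?thesis by (simp add: N_def)
qed

fun check_points :: "int \<Rightarrow> (int \<times> int list) list \<Rightarrow> (int \<times> int) list \<Rightarrow> bool" where
  "check_points N qs (a # b # c # ps) \<longleftrightarrow> check_point N qs a b c \<and> check_points N qs (b # c # ps)"
| "check_points N qs ps \<longleftrightarrow> True"

fun check_order :: "(int \<times> int) list \<Rightarrow> bool" where
  "check_order (a # b # ps) \<longleftrightarrow> 0 < snd a \<and> fst a * snd b < fst b * snd a \<and> check_order (b # ps)"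
| "check_order [a] \<longleftrightarrow> 0 < snd a"
| "check_order [] \<longleftrightarrow> True"

definition check_flip :: "int list \<Rightarrow> int \<times> int \<Rightarrow> int \<times> int \<Rightarrow> bool" where
  "check_flip q a b \<longleftrightarrow> fst (hom_eval (fst a) (snd a) q) * fst (hom_eval (fst b) (snd b) q) < 0"

fun check_flips :: "(int \<times> int list) list \<Rightarrow> (int \<times> int) list \<Rightarrow> nat list \<Rightarrow> bool" where
  "check_flips qs (a # b # ps) (f # fs) \<longleftrightarrow> check_flip (snd (qs ! f)) a b \<and> check_flips qs (b # ps) fs"
| "check_flips qs ps fs \<longleftrightarrow> True"

lemma check_points_nth:
  "check_points N qs ps \<Longrightarrow> Suc (Suc i) < length ps \<Longrightarrow> check_point N qs (ps ! i) (ps ! Suc i) (ps ! Suc (Suc i))"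
proof (induction N qs ps arbitrary: i rule: check_points.induct)
  case (1 N qs a b c ps)
  thus ?case by (cases i) auto
qed auto

lemma check_points_append:
  assumes "check_points N qs (xs @ take (Suc (Suc 0)) ys)" "check_points N qs (ys @ zs)" "2 \<le> length ys"
  shows "check_points N qs (xs @ ys @ zs)"
proof -
  obtain a b ys' where ys: "ys = a # b # ys'"
    using assms(3) by (metis Suc_le_length_iff numeral_2_eq_2)
  from assms(1,2) show ?thesis unfolding ys
  proof (induction xs)
    case (Cons c xs)
    consider "xs = []" | d where "xs = [d]" | d e vs where "xs = d # e # vs"
      by (metis neq_Nil_conv)
    thus ?case using Cons by cases auto
  qed simp
qed

lemma check_order_pos: "check_order ps \<Longrightarrow> i < length ps \<Longrightarrow> 0 < snd (ps ! i)"
proof (induction ps arbitrary: i rule: check_order.induct)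
  case (1 a b ps)
  thus ?case by (cases i) auto
qed auto

lemma check_order_less:
  "check_order ps \<Longrightarrow> Suc i < length ps \<Longrightarrow> frac_of (ps ! i) < frac_of (ps ! Suc i)"
proof (induction ps arbitrary: i rule: check_order.induct)
  case (1 a b ps)
  have "0 < snd a" "0 < snd b" using 1(2) check_order_pos[of "b # ps" 0] by auto
  moreover have "real_of_int (fst a * snd b) < of_int (fst b * snd a)"
    using 1(2) unfolding of_int_less_iff by simp
  ultimately have "frac_of a < frac_of b" by (simp add: field_simps)
  with 1 show ?case by (cases i) auto
qed auto

lemma check_flips_nth:
  "check_flips qs ps fs \<Longrightarrow> i < length fs \<Longrightarrow> Suc i < length ps \<Longrightarrow>
     check_flip (snd (qs ! (fs ! i))) (ps ! i) (ps ! Suc i)"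
proof (induction qs ps fs arbitrary: i rule: check_flips.induct)
  case (1 qs a b ps f fs)
  thus ?case by (cases i) auto
qed auto

lemma check_flip:
  assumes "check_flip q a b" "0 < snd a" "0 < snd b"
  shows "poly (rpoly q) (frac_of a) * poly (rpoly q) (frac_of b) < 0"
proof -
  have pos: "\<exists>c>0. real_of_int (fst (hom_eval (fst a) (snd a) q)) = c * poly (rpoly q) (frac_of a)"
    if "snd a > 0" for a
  proof -
    obtain h v P where e: "hom_eval (fst a) (snd a) q = (h, v, P)" by (metis prod_cases3)
    have "of_int h * of_int (snd a) = of_int (snd a) ^ length q * poly (rpoly q) (frac_of a)"
      using hom_eval[OF that e refl] by simp
    hence "of_int h = (of_int (snd a) ^ length q / of_int (snd a)) * poly (rpoly q) (frac_of a)"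
      using that by (simp add: field_simps)
    thus ?thesis using that e by (intro exI[of _ "of_int (snd a) ^ length q / of_int (snd a)"]) auto
  qed
  obtain c c' where c: "c > 0" "real_of_int (fst (hom_eval (fst a) (snd a) q)) = c * poly (rpoly q) (frac_of a)"
    and c': "c' > 0" "real_of_int (fst (hom_eval (fst b) (snd b) q)) = c' * poly (rpoly q) (frac_of b)"
    using pos[OF assms(2)] pos[OF assms(3)] by metis
  have "real_of_int (fst (hom_eval (fst a) (snd a) q) * fst (hom_eval (fst b) (snd b) q)) < 0"
    using assms(1) unfolding check_flip_def of_int_less_0_iff .
  hence "(c * c') * (poly (rpoly q) (frac_of a) * poly (rpoly q) (frac_of b)) < 0"
    using c(2) c'(2) by (simp add: mult_ac)
  moreover have "c * c' > 0" using c c' by simp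
  ultimately show ?thesis by (metis mult_less_0_iff less_asym)
qed

lemma degree_Poly_eq:
  assumes "q \<noteq> []" "last q \<noteq> (0::int)"
  shows "Poly q \<noteq> 0 \<and> degree (Poly q) = length q - 1"
  using assms
proof (induction q)
  case (Cons a q)
  thus ?case by (cases "q = []") (auto simp: Suc_diff_Suc)
qed simp

text \<open>
The factors \<open>t\<close> and \<open>1 - 4t\<close> are required because they keep the first and last sample points, which lie
outside the open interval from 0 to \<open>1/4\<close>, from being selected: there one of the two factors has the wrong sign.
\<close>

lemma log_sum_le:
  fixes qs :: "(int \<times> int list) list" and ps :: "(int \<times> int) list" and fs :: "nat list"
  assumes ends_in: "(k0, [0, 1]) \<in> set qs" "(k1, [1, -4]) \<in> set qs"
    and shape: "list_all (\<lambda>(k, q). 0 \<le> k \<and> q \<noteq> [] \<and> last q \<noteq> 0) qs"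
      "map (count_list fs) [0..<length qs] = map (\<lambda>(k, q). length q - 1) qs"
      "list_all (\<lambda>f. f < length qs) fs"
      "length ps = Suc (length fs)"
    and chk: "check_order ps" "check_flips qs ps fs" "check_points (total_degree qs) qs ps"
    and ends: "frac_of (ps ! 0) \<le> 0" "1 / 4 \<le> frac_of (ps ! length fs)"
    and t: "0 \<le> t" "t \<le> 1 / 4" "\<And>k q. (k, q) \<in> set qs \<Longrightarrow> poly (rpoly q) t \<noteq> 0"
  shows "(\<Sum>(k, q)\<leftarrow>qs. of_int k * ln \<bar>poly (rpoly q) t\<bar>) \<le> - 1.721178 * of_int (total_degree qs)"
proof -
  define p where "p j = rpoly (snd (qs ! j))" for j
  define \<tau> where "\<tau> i = frac_of (ps ! i)" for i
  define J where "J = length qs"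
  define K where "K = length fs"
  have mem: "(fst (qs ! j), snd (qs ! j)) \<in> set qs" if "j < J" for j using that by (simp add: J_def)
  have qs: "0 \<le> k" "q \<noteq> []" "last q \<noteq> 0" if "(k, q) \<in> set qs" for k q
    using shape(1) that by (auto simp: list_all_iff)
  have p: "p j \<noteq> 0 \<and> degree (p j) = length (snd (qs ! j)) - 1" if "j < J" for j
  proof -
    note P = degree_Poly_eq[OF qs(2,3)[OF mem[OF that]]]
    have "degree (p j) = degree (Poly (snd (qs ! j)))" unfolding p_def by (rule of_int_hom.degree_map_poly_hom)
    moreover have "p j \<noteq> 0" using P unfolding p_def by simp
    ultimately show ?thesis using P by simp
  qed
  have pos: "0 < snd (ps ! i)" if "i \<le> K" for i
    using check_order_pos[OF chk(1), of i] that shape(4) by (simp add: K_def)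
  have mono: "\<tau> i < \<tau> (Suc i)" if "i < K" for i
    unfolding \<tau>_def using check_order_less[OF chk(1), of i] that shape(4) by (simp add: K_def)
  have change: "poly (p (fs ! i)) (\<tau> i) * poly (p (fs ! i)) (\<tau> (Suc i)) < 0" if "i < K" for i
    unfolding p_def \<tau>_def
    using check_flips_nth[OF chk(2), of i] that shape(4) pos[of i] pos[of "Suc i"]
    by (intro check_flip) (auto simp: K_def)
  have deg: "degree (p j) = card {i. i < K \<and> fs ! i = j}" if "j < J" for j
  proof -
    have "map (count_list fs) [0..<length qs] ! j = map (\<lambda>(k, q). length q - 1) qs ! j"
      using shape(2) by simp
    hence "count_list fs j = length (snd (qs ! j)) - 1"
      using that by (simp add: J_def case_prod_unfold)
    moreover have "count_list fs j = card {i. i < K \<and> j = fs ! i}"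
      by (simp add: count_list_eq_length_filter length_filter_conv_card K_def)
    moreover have "{i. i < K \<and> j = fs ! i} = {i. i < K \<and> fs ! i = j}" by auto
    ultimately show ?thesis using p[OF that] by simp
  qed
  have "t \<noteq> 0"
    using t(3)[OF ends_in(1)] by (auto simp: map_poly_pCons)
  have "t \<noteq> 1 / 4"
    using t(3)[OF ends_in(2)] by (auto simp: map_poly_pCons)
  have tJ: "poly (p j) t \<noteq> 0" if "j < J" for j
    using t(3) mem[OF that] unfolding p_def by blast
  have ends': "\<tau> 0 \<le> 0" "1 / 4 \<le> \<tau> K" using ends unfolding \<tau>_def K_def .
  hence "\<tau> 0 \<le> t" "t < \<tau> K" using t(1,2) \<open>t \<noteq> 1 / 4\<close> by linarith+
  then obtain i where i: "i \<le> K" "0 < i \<Longrightarrow> \<tau> (i - 1) \<le> t" "i < K \<Longrightarrow> t \<le> \<tau> (Suc i)"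
    "\<And>j. j < J \<Longrightarrow> 0 < poly (p j) t * poly (p j) (\<tau> i)"
    "\<And>j. j < J \<Longrightarrow> ln \<bar>poly (p j) t\<bar> \<le> ln \<bar>poly (p j) (\<tau> i)\<bar> +
        (t - \<tau> i) * (poly (pderiv (p j)) (\<tau> i) / poly (p j) (\<tau> i))"
    using tangent_at_separating_point[of K \<tau> p "\<lambda>i. fs ! i" J t] mono change deg p tJ by blast
  obtain j0 j1 where j: "j0 < J" "qs ! j0 = (k0, [0, 1])" "j1 < J" "qs ! j1 = (k1, [1, -4])"
    using ends_in by (metis in_set_conv_nth J_def)
  have "0 < t * \<tau> i"
    using i(4)[OF j(1)] by (simp add: p_def j(2) map_poly_pCons)
  hence "0 < \<tau> i" using t(1) by (simp add: zero_less_mult_iff)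
  hence "i \<noteq> 0" using ends'(1) by (cases i) auto
  have "0 < (1 - 4 * t) * (1 - 4 * \<tau> i)"
    using i(4)[OF j(3)] by (simp add: p_def j(4) map_poly_pCons algebra_simps)
  hence "\<tau> i < 1 / 4" using t(2) by (auto simp: zero_less_mult_iff)
  hence "i \<noteq> K" using ends'(2) by (metis not_less)
  then obtain l where l: "i = Suc l" "Suc (Suc l) \<le> K" using i(1) \<open>i \<noteq> 0\<close> by (cases i) auto
  have "check_point (total_degree qs) qs (ps ! l) (ps ! Suc l) (ps ! Suc (Suc l))"
    using check_points_nth[OF chk(3), of l] l shape(4) by (simp add: K_def)
  hence "check_point (total_degree qs) qs (fst (ps ! l), snd (ps ! l)) (fst (ps ! Suc l), snd (ps ! Suc l))
      (fst (ps ! Suc (Suc l)), snd (ps ! Suc (Suc l)))" by simp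
  hence main: "(\<Sum>(k, q)\<leftarrow>qs. of_int k * (ln \<bar>poly (rpoly q) (\<tau> i)\<bar> +
      (t - \<tau> i) * (poly (pderiv (rpoly q)) (\<tau> i) / poly (rpoly q) (\<tau> i)))) \<le> - 1.721178 * of_int (total_degree qs)"
  proof (rule check_point)
    show "frac_of (fst (ps ! l), snd (ps ! l)) \<le> t" "t \<le> frac_of (fst (ps ! Suc (Suc l)), snd (ps ! Suc (Suc l)))"
      using i(2,3) l by (simp_all add: \<tau>_def)
    show "frac_of (fst (ps ! l), snd (ps ! l)) \<le> frac_of (fst (ps ! Suc l), snd (ps ! Suc l))"
      "frac_of (fst (ps ! Suc l), snd (ps ! Suc l)) \<le> frac_of (fst (ps ! Suc (Suc l)), snd (ps ! Suc (Suc l)))"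
      using mono[of l] mono[of "Suc l"] l by (simp_all add: \<tau>_def)
    fix k q assume kq: "(k, q) \<in> set qs"
    then obtain j where j: "j < J" "qs ! j = (k, q)" by (auto simp: in_set_conv_nth J_def)
    have "poly (p j) (\<tau> i) \<noteq> 0" using i(4)[OF j(1)] by auto
    thus "0 \<le> k \<and> q \<noteq> [] \<and> poly (rpoly q) (\<tau> i) \<noteq> 0" using qs[OF kq] j(2) by (simp add: p_def)
  qed (use pos l in \<open>simp_all add: \<tau>_def\<close>)
  have "(\<Sum>(k, q)\<leftarrow>qs. of_int k * ln \<bar>poly (rpoly q) t\<bar>) \<le>
     (\<Sum>(k, q)\<leftarrow>qs. of_int k * (ln \<bar>poly (rpoly q) (\<tau> i)\<bar> +
      (t - \<tau> i) * (poly (pderiv (rpoly q)) (\<tau> i) / poly (rpoly q) (\<tau> i))))"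
  proof (rule sum_list_mono, clarify)
    fix k q assume kq: "(k, q) \<in> set qs"
    then obtain j where j: "j < J" "qs ! j = (k, q)" by (auto simp: in_set_conv_nth J_def)
    show "real_of_int k * ln \<bar>poly (rpoly q) t\<bar> \<le> of_int k * (ln \<bar>poly (rpoly q) (\<tau> i)\<bar> +
      (t - \<tau> i) * (poly (pderiv (rpoly q)) (\<tau> i) / poly (rpoly q) (\<tau> i)))"
      using i(5)[OF j(1)] j(2) qs(1)[OF kq] by (intro mult_left_mono) (simp_all add: p_def)
  qed
  with main show ?thesis by linarith
qed

section \<open>The auxiliary polynomials and their certificate\<close>

text \<open>
Found by linear programming together with lattice reduction.  The weights, in units of about \<open>10\<^sup>-\<^sup>5\<close>,
solve, up to rounding, the linear program that minimises the maximum over \<open>[0,1/4]\<close> of the weighted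
sum of the logarithms for a fixed weighted degree.
\<close>

definition aux_polys :: "(int \<times> int list) list" where
  "aux_polys =
    [(62695, [0, 1]),
     (378, [1, -6]),
     (7517, [1, -5]),
     (11322, [1, -4]),
     (124, [1, -12, 33]),
     (90, [1, -12, 34]),
     (2672, [1, -11, 29]),
     (27, [2, -20, 49]),
     (80, [1, -18, 104, -193]),
     (24, [1, -18, 105, -199]),
     (683, [1, -17, 94, -169]),
     (672, [1, -23, 193, -703, 941]),
     (362, [1, -23, 194, -712, 961]),
     (77, [1, -29, 330, -1845, 5075, -5501]),
     (24, [1, -29, 331, -1860, 5149, -5621]),
     (91, [1, -35, 502, -3779, 15761, -34564, 31169]),
     (16, [1, -41, 709, -6712, 37610, -124859, 227590, -175849]),
     (36, [1, -41, 709, -6711, 37592, -124738, 227230, -175449]),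
     (102, [1, -41, 710, -6737, 37859, -126093, 230631, -178829]),
     (29, [1, -41, 710, -6737, 37860, -126107, 230696, -178929]),
     (38, [1, -41, 711, -6764, 38144, -127568, 234384, -182593]),
     (106, [1, -41, 711, -6763, 38125, -127434, 233968, -182113]),
     (72, [1, -47, 951, -10836, 76143, -338252, 928579, -1441511, 969581]),
     (54, [2, -90, 1752, -19284, 131351, -567289, 1517930, -2301872, 1515361]),
     (12, [1, -53, 1235, -16614, 142262, -804436, 3005114, -7154429, 9853737, -5984086]),
     (72, [1, -53, 1236, -16651, 142843, -809458, 3030935, -7233442, 9987042, -6079786]),
     (32, [1, -59, 1553, -24022, 241870, -1656781, 7820814, -25127290, 52597863, -64788879, 35669071]),
     (34, [1, -59, 1554, -24067, 242749, -1666517, 7887708, -25419300, 53388915, -66005023, 36481616])]"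

text \<open>
Simple fractions near the local maxima of the weighted sum of logarithms, one between any two
consecutive roots of the auxiliary polynomials, with one point added beyond each end of \<open>[0,1/4]\<close>.
\<close>

definition points1 :: "(int \<times> int) list" where
  "points1 =
    [(-1, 1000), (37, 380), (21, 202), (13, 124), (33, 313), (28, 263), (10, 93), (48, 439),
     (15, 137), (9, 82), (17, 154), (37, 332)]"

definition points2 :: "(int \<times> int) list" where
  "points2 =
    [(19, 169), (4, 35), (13, 112), (9, 77), (15, 124), (79, 645), (29, 234), (44, 347), (7, 55),
     (81, 632), (41, 319), (46, 355)]"

definition points3 :: "(int \<times> int) list" where
  "points3 =
    [(37, 284), (25, 191), (13, 99), (11, 83), (33, 248), (31, 232), (11, 82), (7, 52), (8, 59),
     (49, 359), (19, 136), (8, 57)]"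

definition points4 :: "(int \<times> int) list" where
  "points4 =
    [(13, 92), (33, 233), (41, 288), (45, 313), (33, 226), (166, 1067), (46, 291), (17, 107),
     (35, 219), (21, 131), (45, 277), (93, 569)]"

definition points5 :: "(int \<times> int) list" where
  "points5 =
    [(39, 238), (107, 651), (69, 419), (68, 411), (30, 179), (67, 398), (51, 301), (259, 1502),
     (56, 323), (33, 190), (42, 241), (11, 63)]"

definition points6 :: "(int \<times> int) list" where
  "points6 =
    [(169, 967), (45, 257), (10, 57), (51, 290), (92, 521), (37, 209), (13, 73), (89, 499),
     (37, 207), (52, 287), (47, 259), (105, 577)]"

definition points7 :: "(int \<times> int) list" where
  "points7 =
    [(17, 93), (11, 60), (73, 397), (67, 362), (29, 156), (19, 102), (20, 107), (107, 570),
     (214, 1011), (43, 202), (28, 131), (67, 312)]"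

definition points8 :: "(int \<times> int) list" where
  "points8 =
    [(17, 79), (11, 51), (19, 88), (29, 134), (64, 295), (53, 244), (52, 239), (22, 101),
     (71, 325), (83, 379), (53, 240), (19, 86)]"

definition points9 :: "(int \<times> int) list" where
  "points9 =
    [(79, 357), (39, 176), (335, 1508), (39, 175), (31, 139), (25, 112), (19, 85), (111, 496),
     (109, 486), (96, 425), (147, 640), (41, 178)]"

definition points10 :: "(int \<times> int) list" where
  "points10 =
    [(19, 82), (42, 181), (10, 43), (61, 262), (31, 133), (326, 1397), (46, 197), (174, 745),
     (29, 124), (100, 427), (137, 584), (127, 541)]"

definition points11 :: "(int \<times> int) list" where
  "points11 =
    [(267, 1135), (57, 242), (33, 139), (11, 46), (92, 383), (83, 345), (871, 3617), (67, 278),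
     (62, 257), (155, 642), (22, 91), (202, 835)]"

definition points12 :: "(int \<times> int) list" where
  "points12 =
    [(23, 95), (55, 227), (41, 169), (109, 449), (146, 601), (151, 621), (105, 431), (89, 365),
     (227, 930), (251, 1000)]"

text \<open>
Entry \<open>i\<close> is the index of the polynomial whose root lies between the sample points \<open>i\<close> and \<open>i+1\<close>.
\<close>

definition flips :: "nat list" where
  "flips =
    [0, 22, 16, 24, 17, 26, 18, 27, 25, 19, 20, 23, 21, 13, 15, 11, 14, 8, 12, 9, 25, 24, 4, 27,
     26, 19, 22, 15, 18, 21, 17, 5, 26, 10, 23, 27, 16, 20, 25, 24, 6, 14, 27, 13, 20, 12, 21,
     26, 25, 16, 22, 1, 23, 18, 11, 17, 24, 8, 19, 26, 20, 7, 27, 15, 9, 21, 14, 22, 10, 24, 19,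
     13, 23, 27, 18, 25, 17, 26, 16, 2, 15, 25, 12, 27, 26, 24, 22, 18, 14, 23, 20, 5, 19, 11,
     16, 21, 24, 27, 13, 22, 25, 17, 23, 9, 26, 6, 19, 15, 17, 21, 27, 7, 24, 25, 26, 22, 23, 4,
     16, 18, 20, 11, 10, 12, 22, 15, 16, 23, 17, 8, 24, 13, 18, 25, 26, 27, 20, 21, 19, 14, 3]"

text \<open>
Unfolding the list only under \<open>totals\<close> keeps it an opaque constant everywhere else during evaluation.
\<close>

lemma totals_aux_polys: "totals n d aux_polys = totals n d
    [(62695, [0, 1]),
     (378, [1, -6]),
     (7517, [1, -5]),
     (11322, [1, -4]),
     (124, [1, -12, 33]),
     (90, [1, -12, 34]),
     (2672, [1, -11, 29]),
     (27, [2, -20, 49]),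
     (80, [1, -18, 104, -193]),
     (24, [1, -18, 105, -199]),
     (683, [1, -17, 94, -169]),
     (672, [1, -23, 193, -703, 941]),
     (362, [1, -23, 194, -712, 961]),
     (77, [1, -29, 330, -1845, 5075, -5501]),
     (24, [1, -29, 331, -1860, 5149, -5621]),
     (91, [1, -35, 502, -3779, 15761, -34564, 31169]),
     (16, [1, -41, 709, -6712, 37610, -124859, 227590, -175849]),
     (36, [1, -41, 709, -6711, 37592, -124738, 227230, -175449]),
     (102, [1, -41, 710, -6737, 37859, -126093, 230631, -178829]),
     (29, [1, -41, 710, -6737, 37860, -126107, 230696, -178929]),
     (38, [1, -41, 711, -6764, 38144, -127568, 234384, -182593]),
     (106, [1, -41, 711, -6763, 38125, -127434, 233968, -182113]),
     (72, [1, -47, 951, -10836, 76143, -338252, 928579, -1441511, 969581]),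
     (54, [2, -90, 1752, -19284, 131351, -567289, 1517930, -2301872, 1515361]),
     (12, [1, -53, 1235, -16614, 142262, -804436, 3005114, -7154429, 9853737, -5984086]),
     (72, [1, -53, 1236, -16651, 142843, -809458, 3030935, -7233442, 9987042, -6079786]),
     (32, [1, -59, 1553, -24022, 241870, -1656781, 7820814, -25127290, 52597863, -64788879, 35669071]),
     (34, [1, -59, 1554, -24067, 242749, -1666517, 7887708, -25419300, 53388915, -66005023, 36481616])]"
  by (simp only: aux_polys_def)

lemma length_aux_polys: "int (length aux_polys) = 28"
  by (simp add: aux_polys_def)

lemma divmod_step_int:
  "divmod_step (l::int) (q, r) = (if \<bar>l\<bar> \<le> \<bar>r\<bar> then (2 * q + 1, r - l) else (2 * q, r))"
  by (simp add: divmod_step_def euclidean_size_int_def nat_le_eq_zle)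

lemma sgn_abs_numeral:
  "sgn (numeral k :: int) = 1" "sgn (- numeral k :: int) = - 1" "sgn (0::int) = 0" "sgn (1::int) = 1"
  "sgn (- 1::int) = - 1" "\<bar>- 1 :: int\<bar> = 1"
  by simp_all

text \<open>
A complete set of rules for evaluating the checks on numerals.  Restricting rewriting to them, with lazy
conditionals, keeps out the simplification procedures of the default simpset, which would be tried in every step.
\<close>

lemmas evaluation =
  hom_eval.simps totals.simps add_term.simps add_log.simps add_denominator.simps total_le.simps
  check_point.simps check_points.simps artanh_step_def artanh_poly_def artanh_bound_def
  ln_ratio_bound_def log2_floor_numeral double_pow2.simps trunc_quot_def max_def
  arith_simps arith_special mult_1_left mult_1_right mult_minus1 mult_minus1_right minus_minus
  numeral_One uminus_numeral_One numeral_div_numeral divmod_algorithm_code divmod_step_int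
  div_by_1 div_0 one_div_numeral sgn_abs_numeral
  fst_conv snd_conv prod.case if_True if_False rel_simps simp_thms
  totals_aux_polys length_aux_polys

lemma check_points1: "check_points 99999 aux_polys (points1 @ take (Suc (Suc 0)) points2)"
  unfolding points1_def points2_def append.simps take_Suc_Cons take_0
  by (simp only: evaluation cong: if_weak_cong)

lemma check_points2: "check_points 99999 aux_polys (points2 @ take (Suc (Suc 0)) points3)"
  unfolding points2_def points3_def append.simps take_Suc_Cons take_0
  by (simp only: evaluation cong: if_weak_cong)

lemma check_points3: "check_points 99999 aux_polys (points3 @ take (Suc (Suc 0)) points4)"
  unfolding points3_def points4_def append.simps take_Suc_Cons take_0
  by (simp only: evaluation cong: if_weak_cong)

lemma check_points4: "check_points 99999 aux_polys (points4 @ take (Suc (Suc 0)) points5)"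
  unfolding points4_def points5_def append.simps take_Suc_Cons take_0
  by (simp only: evaluation cong: if_weak_cong)

lemma check_points5: "check_points 99999 aux_polys (points5 @ take (Suc (Suc 0)) points6)"
  unfolding points5_def points6_def append.simps take_Suc_Cons take_0
  by (simp only: evaluation cong: if_weak_cong)

lemma check_points6: "check_points 99999 aux_polys (points6 @ take (Suc (Suc 0)) points7)"
  unfolding points6_def points7_def append.simps take_Suc_Cons take_0
  by (simp only: evaluation cong: if_weak_cong)

lemma check_points7: "check_points 99999 aux_polys (points7 @ take (Suc (Suc 0)) points8)"
  unfolding points7_def points8_def append.simps take_Suc_Cons take_0
  by (simp only: evaluation cong: if_weak_cong)

lemma check_points8: "check_points 99999 aux_polys (points8 @ take (Suc (Suc 0)) points9)"
  unfolding points8_def points9_def append.simps take_Suc_Cons take_0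
  by (simp only: evaluation cong: if_weak_cong)

lemma check_points9: "check_points 99999 aux_polys (points9 @ take (Suc (Suc 0)) points10)"
  unfolding points9_def points10_def append.simps take_Suc_Cons take_0
  by (simp only: evaluation cong: if_weak_cong)

lemma check_points10: "check_points 99999 aux_polys (points10 @ take (Suc (Suc 0)) points11)"
  unfolding points10_def points11_def append.simps take_Suc_Cons take_0
  by (simp only: evaluation cong: if_weak_cong)

lemma check_points11: "check_points 99999 aux_polys (points11 @ take (Suc (Suc 0)) points12)"
  unfolding points11_def points12_def append.simps take_Suc_Cons take_0
  by (simp only: evaluation cong: if_weak_cong)

lemma check_points12: "check_points 99999 aux_polys (points12 @ [])"
  unfolding points12_def append.simps
  by (simp only: evaluation cong: if_weak_cong)

definition sample_points :: "(int \<times> int) list" where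
  "sample_points = points1 @ points2 @ points3 @ points4 @ points5 @ points6 @
     points7 @ points8 @ points9 @ points10 @ points11 @ points12 @ []"

lemma check_sample_points: "check_points 99999 aux_polys sample_points"
  unfolding sample_points_def
  by (intro check_points_append check_points1 check_points2 check_points3 check_points4 check_points5 check_points6
       check_points7 check_points8 check_points9 check_points10 check_points11 check_points12)
     (simp_all add: points1_def points2_def points3_def points4_def points5_def points6_def points7_def
       points8_def points9_def points10_def points11_def points12_def)

lemma check_order_sample_points: "check_order sample_points"
  by (simp add: sample_points_def points1_def points2_def points3_def points4_def points5_def points6_def points7_def points8_def points9_def points10_def points11_def points12_def)

lemma check_flips_sample_points: "check_flips aux_polys sample_points flips"
  unfolding sample_points_def points1_def points2_def points3_def points4_def points5_def points6_def points7_def points8_def points9_def points10_def points11_def points12_def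
    flips_def append.simps append_Nil2 check_flips.simps check_flip_def fst_conv snd_conv
  by (simp add: aux_polys_def del: hom_eval.simps) (simp only: evaluation cong: if_weak_cong)

lemma aux_polys_shape:
  "list_all (\<lambda>(k, q). 0 \<le> k \<and> q \<noteq> [] \<and> last q \<noteq> 0) aux_polys"
  "map (count_list flips) [0..<length aux_polys] = map (\<lambda>(k, q). length q - 1) aux_polys"
  "list_all (\<lambda>f. f < length aux_polys) flips"
  "length sample_points = Suc (length flips)"
  "total_degree aux_polys = 99999"
  by (simp_all add: aux_polys_def flips_def sample_points_def total_degree_def upt_conv_Cons
       points1_def points2_def points3_def points4_def points5_def points6_def points7_def points8_def points9_def points10_def points11_def points12_def)

section \<open>The lower bound\<close>

lemma aux_polys_ends: "(62695, [0, 1]) \<in> set aux_polys" "(11322, [1, -4]) \<in> set aux_polys"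
  by (simp_all add: aux_polys_def)

lemma ln_target: "ln 1.53770952 < (0.430294 :: real)"
proof -
  have "ln 1.53770952 \<le> (\<Sum>k<7. 2 * ((1.53770952 - 1) / (1.53770952 + 1)) ^ (2 * k + 1) / real (2 * k + 1)) +
      2 * (((1.53770952 - 1) / (1.53770952 + 1)) ^ (2 * 7 + 1) / (1 - ((1.53770952 - 1) / (1.53770952 + 1))\<^sup>2) / real (2 * 7 + 1) :: real)"
    using ln_approx_bounds[of "1.53770952" 7] by simp
  also have "\<dots> < 0.430294"
    by (simp add: eval_nat_numeral)
  finally show ?thesis .
qed

text \<open>
The substitution \<open>t = x\<^sup>2 - x\<^sup>4\<close> multiplies degrees by 4, so the bound \<open>-1.721178\<close> per unit of degree
in \<open>t\<close> becomes the exponent \<open>1.721178/4 = 0.4302945\<close>, which exceeds \<open>ln 1.53770952\<close>.  The difference absorbs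
the bounded number of lost roots once \<open>n\<close> is large.
\<close>

theorem lower_bound:
  "ereal 1.53770952 \<le> min_leading_growth (complex_of_real ` {-1..1})"
proof -
  define E where "E = complex_of_real ` {-1..1}"
  define I where "I = {..<length aux_polys}"
  define q where "q j = snd (aux_polys ! j)" for j
  define Q where "Q j = pcompose (Poly (q j)) [:0, 0, 1, 0, - 1 :: int:]" for j
  define c where "c j = real_of_int (fst (aux_polys ! j))" for j
  define d where "d = (\<Sum>j\<in>I. degree (Q j))"
  have mem: "(fst (aux_polys ! j), q j) \<in> set aux_polys" if "j \<in> I" for j
    using that by (simp add: I_def q_def)
  have q: "0 \<le> c j" "q j \<noteq> []" "last (q j) \<noteq> 0" if "j \<in> I" for j
    using aux_polys_shape(1) mem[OF that] by (auto simp: list_all_iff c_def)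
  have deg: "degree (Q j) = 4 * (length (q j) - 1)" and nz: "Q j \<noteq> 0" if "j \<in> I" for j
    using degree_Poly_eq[OF q(2,3)[OF that]]
    by (simp_all add: Q_def pcompose_eq_0_iff)
  have sum_eq: "(\<Sum>j\<in>I. c j * g (q j)) = (\<Sum>(k, p)\<leftarrow>aux_polys. of_int k * g p)" for g :: "int list \<Rightarrow> real"
    by (simp add: I_def c_def q_def sum_list_sum_nth case_prod_unfold atLeast0LessThan)
  have weight: "(\<Sum>j\<in>I. c j * real (degree (Q j))) = 4 * 99999"
  proof -
    have "(\<Sum>j\<in>I. c j * real (degree (Q j))) = 4 * (\<Sum>j\<in>I. c j * real (length (q j) - 1))"
      by (simp add: deg sum_distrib_left mult_ac)
    also have "(\<Sum>j\<in>I. c j * real (length (q j) - 1)) = of_int (total_degree aux_polys)"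
      unfolding sum_eq[of "\<lambda>p. real (length p - 1)"] by (rule of_int_total_degree[symmetric])
    finally show ?thesis by (simp add: aux_polys_shape(5))
  qed
  have aux: "(\<Sum>j\<in>I. c j * ln (norm (poly (cpoly (Q j)) z))) \<le> - (1.721178 * 99999)"
    if z: "z \<in> E" and z_nz: "\<And>j. j \<in> I \<Longrightarrow> poly (cpoly (Q j)) z \<noteq> 0" for z
  proof -
    obtain x where x: "z = complex_of_real x" "-1 \<le> x" "x \<le> 1" using z by (auto simp: E_def)
    define t where "t = x ^ 2 - x ^ 4"
    have "x ^ 2 \<le> 1" using x by (simp add: abs_square_le_1 abs_le_iff)
    have "t = x ^ 2 * (1 - x ^ 2)" by (simp add: t_def algebra_simps flip: power_add)
    hence "0 \<le> t" using \<open>x ^ 2 \<le> 1\<close> by simp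
    have "t = 1 / 4 - (x ^ 2 - 1 / 2) ^ 2" by (simp add: t_def power2_eq_square power4_eq_xxxx algebra_simps)
    hence "t \<le> 1 / 4" by simp
    have val: "poly (cpoly (Q j)) z = complex_of_real (poly (rpoly (q j)) t)" for j
    proof -
      have "poly (cpoly (Q j)) z = poly (cpoly (Poly (q j))) (complex_of_real t)"
        by (simp add: Q_def of_int_hom.map_poly_pcompose poly_pcompose map_poly_pCons x(1) t_def
            power2_eq_square power4_eq_xxxx algebra_simps)
      also have "\<dots> = complex_of_real (poly (rpoly (q j)) t)"
        by (simp add: poly_altdef degree_map_poly coeff_map_poly)
      finally show ?thesis .
    qed
    have "(\<Sum>j\<in>I. c j * ln (norm (poly (cpoly (Q j)) z))) = (\<Sum>j\<in>I. c j * ln \<bar>poly (rpoly (q j)) t\<bar>)"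
      by (simp add: val)
    also have "\<dots> = (\<Sum>(k, p)\<leftarrow>aux_polys. of_int k * ln \<bar>poly (rpoly p) t\<bar>)"
      by (rule sum_eq)
    also have "\<dots> \<le> - 1.721178 * of_int (total_degree aux_polys)"
    proof (rule log_sum_le[OF aux_polys_ends aux_polys_shape(1-4) check_order_sample_points check_flips_sample_points])
      show "poly (rpoly p) t \<noteq> 0" if kp: "(k, p) \<in> set aux_polys" for k p
      proof -
        obtain j where "j \<in> I" "aux_polys ! j = (k, p)"
          using kp by (auto simp: in_set_conv_nth I_def)
        thus ?thesis using z_nz[of j] val[of j] by (simp add: q_def)
      qed
      show "check_points (total_degree aux_polys) aux_polys sample_points"
        using check_sample_points by (simp add: aux_polys_shape(5))
      show "frac_of (sample_points ! 0) \<le> 0"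
        by (simp add: sample_points_def points1_def)
      have "sample_points ! length flips = last sample_points"
        using aux_polys_shape(4) by (simp add: last_conv_nth flip: length_0_conv)
      also have "last sample_points = (251, 1000)" by (simp add: sample_points_def points12_def)
      finally show "1 / 4 \<le> frac_of (sample_points ! length flips)" by simp
    qed fact+
    finally show ?thesis by (simp add: aux_polys_shape(5))
  qed
  have aux: "(\<Sum>j\<in>I. c j * ln (norm (poly (cpoly (Q j)) z))) \<le> - (1.721178 * 99999)"
    if z: "z \<in> E" and z_nz: "\<And>j. j \<in> I \<Longrightarrow> poly (cpoly (Q j)) z \<noteq> 0" for z
  proof -
    obtain x where x: "z = complex_of_real x" "-1 \<le> x" "x \<le> 1" using z by (auto simp: E_def)
    define t where "t = x ^ 2 - x ^ 4"
    have "x ^ 2 \<le> 1" using x by (simp add: abs_square_le_1 abs_le_iff)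
    have "t = x ^ 2 * (1 - x ^ 2)" by (simp add: t_def algebra_simps flip: power_add)
    hence "0 \<le> t" using \<open>x ^ 2 \<le> 1\<close> by simp
    have "t = 1 / 4 - (x ^ 2 - 1 / 2) ^ 2" by (simp add: t_def power2_eq_square power4_eq_xxxx algebra_simps)
    hence "t \<le> 1 / 4" by simp
    have val: "poly (cpoly (Q j)) z = complex_of_real (poly (rpoly (q j)) t)" for j
    proof -
      have "poly (cpoly (Q j)) z = poly (cpoly (Poly (q j))) (complex_of_real t)"
        by (simp add: Q_def of_int_hom.map_poly_pcompose poly_pcompose map_poly_pCons x(1) t_def
            power2_eq_square power4_eq_xxxx algebra_simps)
      also have "\<dots> = complex_of_real (poly (rpoly (q j)) t)"
        by (simp add: poly_altdef degree_map_poly coeff_map_poly)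
      finally show ?thesis .
    qed
    have "(\<Sum>j\<in>I. c j * ln (norm (poly (cpoly (Q j)) z))) = (\<Sum>j\<in>I. c j * ln \<bar>poly (rpoly (q j)) t\<bar>)"
      by (simp add: val)
    also have "\<dots> = (\<Sum>(k, p)\<leftarrow>aux_polys. of_int k * ln \<bar>poly (rpoly p) t\<bar>)"
      by (rule sum_eq)
    also have "\<dots> \<le> - 1.721178 * of_int (total_degree aux_polys)"
    proof (rule log_sum_le[OF aux_polys_ends aux_polys_shape(1-4) check_order_sample_points check_flips_sample_points])
      show "poly (rpoly p) t \<noteq> 0" if kp: "(k, p) \<in> set aux_polys" for k p
      proof -
        obtain j where "j \<in> I" "aux_polys ! j = (k, p)"
          using kp by (auto simp: in_set_conv_nth I_def)
        thus ?thesis using z_nz[of j] val[of j] by (simp add: q_def)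
      qed
      show "check_points (total_degree aux_polys) aux_polys sample_points"
        using check_sample_points by (simp add: aux_polys_shape(5))
      show "frac_of (sample_points ! 0) \<le> 0"
        by (simp add: sample_points_def points1_def)
      have "sample_points ! length flips = last sample_points"
        using aux_polys_shape(4) by (simp add: last_conv_nth flip: length_0_conv)
      also have "last sample_points = (251, 1000)" by (simp add: sample_points_def points12_def)
      finally show "1 / 4 \<le> frac_of (sample_points ! length flips)" by simp
    qed (use aux_polys_shape check_order_sample_points check_flips_sample_points \<open>0 \<le> t\<close> \<open>t \<le> 1 / 4\<close>
         in \<open>simp_all add: aux_polys_def\<close>)
    finally show ?thesis by (simp add: aux_polys_shape(5))
  qed
  have main: "0.4302945 * (real n - real d) \<le> ln \<bar>real_of_int (lead_coeff P)\<bar>"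
    if "P \<in> simple_zero_polys n E" for P n
  proof -
    have "1.721178 * 99999 * (real n - real d) \<le> 4 * 99999 * ln \<bar>real_of_int (lead_coeff P)\<bar>"
      unfolding d_def weight[symmetric]
      using nz q(1) aux by (intro auxiliary_function_bound[OF _ _ _ _ _ that]) (auto simp: I_def)
    thus ?thesis by simp
  qed
  show ?thesis
    unfolding min_leading_growth_def E_def[symmetric]
  proof (rule INF_greatest, rule Liminf_bounded)
    fix P :: "nat \<Rightarrow> int poly"
    assume "P \<in> {P. \<forall>n\<ge>1. P n \<in> simple_zero_polys n E}"
    hence P: "P n \<in> simple_zero_polys n E" if "n \<ge> 1" for n using that by auto
    \<comment> \<open>For these \<open>n\<close> the lost roots cost a relative error of at most \<open>10\<^sup>-\<^sup>7\<close>, less than the gap between 0.4302945 and 0.430294.\<close>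
    have "ereal 1.53770952 \<le> ereal (root n \<bar>real_of_int (lead_coeff (P n))\<bar>)"
      if n: "n \<ge> Suc (10000000 * d)" for n
    proof -
      define a where "a = \<bar>real_of_int (lead_coeff (P n))\<bar>"
      have n1: "n \<ge> 1" using n by simp
      have "P n \<noteq> 0" using P[OF n1] by (simp add: simple_zero_polys_def)
      hence a: "a > 0" by (simp add: a_def)
      have "real (10000000 * d) \<le> real n" using n by (intro of_nat_mono) simp
      hence "0.430294 * real n \<le> 0.4302945 * (real n - real d)" by simp
      also have "\<dots> \<le> ln a" using main[OF P[OF n1]] by (simp add: a_def)
      finally have "real n * ln 1.53770952 \<le> ln a"
        using ln_target mult_left_mono[of "ln 1.53770952" "0.430294" "real n"] by simp
      hence "ln (1.53770952 ^ n) \<le> ln a" by (simp add: ln_realpow)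
      hence "1.53770952 ^ n \<le> a" using a by (simp del: ln_realpow)
      hence "root n (1.53770952 ^ n) \<le> root n a" using n1 by (intro real_root_le_mono) auto
      moreover have "root n (1.53770952 ^ n) = (1.53770952 :: real)"
        using n1 by (intro real_root_power_cancel) auto
      ultimately show ?thesis by (simp add: a_def)
    qed
    thus "eventually (\<lambda>n. ereal 1.53770952 \<le> ereal (root n \<bar>real_of_int (lead_coeff (P n))\<bar>)) sequentially"
      by (intro eventually_sequentiallyI)
  qed
qed

theorem theorem2p1:
  shows "ereal 1.53770952 \<le> min_leading_growth (complex_of_real ` {-1..1}) \<and>
         min_leading_growth (complex_of_real ` {-1..1}) \<le> ereal 1.54170092"
  using lower_bound upper_bound by blast

end
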